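(* Let $\lambda>0$, $\mu>0$, $\eta>0$ be constants with $\lambda+\mu>\eta$, and consider, for $(x,t)\in[0,\infty)\times[0,\infty)$, the system $$\frac{\partial p_0(x,t)}{\partial t}+\frac{\partial p_0(x,t)}{\partial x}=-(\lambda+\mu)p_0(x,t),\qquad \frac{\partial p_1(x,t)}{\partial t}+\frac{\partial p_1(x,t)}{\partial x}=-\eta\, p_1(x,t),$$ $$p_0(0,t)=\delta(t)+\eta\int_0^\infty p_1(x,t)\,dx,\qquad p_1(0,t)=\lambda\int_0^\infty p_0(x,t)\,dx,$$ $$p_0(x,0)=\delta(x),\qquad p_1(x,0)=0,$$ where $\delta$ is the Dirac delta function and solutions are understood in the Laplace-transform sense described in the context. Assume that $$\frac{d}{dt}\int_0^\infty p_k(x,t)e^{-sx}\,dx=\int_0^\infty \frac{\partial p_k(x,t)}{\partial t}e^{-sx}\,dx,\qquad k=0,1.$$ Put $$z_1=\frac{-(\lambda+\mu+\eta)+\sqrt{(\lambda+\mu+\eta)^2-4\mu\eta}}{2},\qquad z_2=\frac{-(\lambda+\mu+\eta)-\sqrt{(\lambda+\mu+\eta)^2-4\mu\eta}}{2},$$ $$l_1=\frac{2(z_1+\eta)}{z_1-z_2},\quad l_2=-\frac{2(z_2+\eta)}{z_1-z_2},\quad h_1=\frac{2\lambda}{z_1-z_2},\quad h_2=-\frac{2\lambda}{z_1-z_2}.$$ Then the time-dependent solution of the system is, for $t>0$ (as generalized functions of $x\in[0,\infty)$), $$\begin{aligned} p_0(x,t)&=2e^{-(\lambda+\mu)t}\delta(x-t)+\frac{\lambda\eta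 l_1}{z_1+\eta}e^{z_1t}e^{-(\lambda+\mu-\eta)x}-\frac{\lambda\eta l_1}{z_1+\eta}e^{-\eta t}e^{-(\lambda+\mu-\eta)x}\\ &\quad+\frac{\lambda\eta l_2}{z_2+\eta}e^{z_2t}e^{-(\lambda+\mu-\eta)x}-\frac{\lambda\eta l_2}{z_2+\eta}e^{-\eta t}e^{-(\lambda+\mu-\eta)x}\\ &\quad-\frac{\lambda\eta l_1}{z_1+\eta}e^{z_1t}e^{-(\lambda+\mu-\eta)x}+\frac{\lambda\eta l_1}{z_1+\eta}e^{z_1t}e^{-(\lambda+\mu+z_1)x}\\ &\quad+\frac{\lambda\eta l_1}{z_1+\eta}e^{-(\lambda+\mu)t}\int_0^xe^{-(\lambda+\mu-\eta)(x-z)}\delta(z-t)\,dz\\ &\quad-\frac{\lambda\eta l_1}{z_1+\eta}e^{-(\lambda+\mu)t}\int_0^xe^{-(\lambda+\mu+z_1)(x-z)}\delta(z-t)\,dz\\ &\quad-\frac{\lambda\eta l_2}{z_2+\eta}e^{z_2t}e^{-(\lambda+\mu-\eta)x}+\frac{\lambda\eta l_2}{z_2+\eta}e^{z_2t}e^{-(\lambda+\mu+z_2)x}\\ &\quad+\frac{\lambda\eta l_2}{z_2+\eta}e^{-(\lambda+\mu)t}\int_0^xe^{-(\lambda+\mu-\eta)(x-z)}\delta(z-t)\,dz\\ &\quad-\frac{\lambda\eta l_2}{z_2+\eta}e^{-(\lambda+\mu)t}\int_0^xe^{-(\lambda+\mu+z_2)(x-z)}\delta(z-t)\,dz, \end{aligned}$$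 $$\begin{aligned} p_1(x,t)&=2\lambda e^{(\lambda+\mu-\eta)x}e^{-(\lambda+\mu)t}-2\lambda e^{-\eta t}\int_0^xe^{(\lambda+\mu-\eta)(x-z)}\delta(z-t)\,dz\\ &\quad+\frac{\lambda\eta h_1}{\lambda+\mu+z_1}e^{z_1t}e^{(\lambda+\mu-\eta)x}-\frac{\lambda\eta h_1}{\lambda+\mu+z_1}e^{-(\lambda+\mu)t}e^{(\lambda+\mu-\eta)x}\\ &\quad+\frac{\lambda\eta h_2}{\lambda+\mu+z_2}e^{z_2t}e^{(\lambda+\mu-\eta)x}-\frac{\lambda\eta h_2}{\lambda+\mu+z_2}e^{-(\lambda+\mu)t}e^{(\lambda+\mu-\eta)x}\\ &\quad-\frac{\lambda\eta h_1}{\lambda+\mu+z_1}e^{z_1t}e^{(\lambda+\mu-\eta)x}+\frac{\lambda\eta h_1}{\lambda+\mu+z_1}e^{z_1t}e^{-(\eta+z_1)x}\\ &\quad+\frac{\lambda\eta h_1}{\lambda+\mu+z_1}e^{-\eta t}\int_0^xe^{(\lambda+\mu-\eta)(x-z)}\delta(z-t)\,dz\\ &\quad-\frac{\lambda\eta h_1}{\lambda+\mu+z_1}e^{-\eta t}\int_0^xe^{-(\eta+z_1)(x-z)}\delta(z-t)\,dz\\ &\quad-\frac{\lambda\eta h_2}{\lambda+\mu+z_2}e^{z_2t}e^{(\lambda+\mu-\eta)x}+\frac{\lambda\eta h_2}{\lambda+\mu+z_2}e^{z_2t}e^{-(\eta+z_2)x}\\ &\quad+\frac{\lambda\eta h_2}{\lambda+\mu+z_2}e^{-\eta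 t}\int_0^xe^{(\lambda+\mu-\eta)(x-z)}\delta(z-t)\,dz\\ &\quad-\frac{\lambda\eta h_2}{\lambda+\mu+z_2}e^{-\eta t}\int_0^xe^{-(\eta+z_2)(x-z)}\delta(z-t)\,dz. \end{aligned}$$ Consequently, for each fixed $x$, $$\lim_{t\to\infty}p_0(x,t)=0,\qquad \lim_{t\to\infty}p_1(x,t)=0.$$
   Context: Delta-function conventions: the delta carries its full unit mass at the endpoint $0$, i.e. $\int_0^\infty e^{-sx}\delta(x)\,dx=1$ and $\int_0^t\delta(y)f(y)\,dy=f(0)$ for $t>0$ and continuous $f$. For $t>0$, $\delta(x-t)$ is the unit point mass at $x=t$ (so $\delta(x-t)=0$ for $x\neq t$ and $\int_0^\infty e^{-sx}\delta(x-t)\,dx=e^{-st}$), and $\int_0^x g(z)\delta(z-t)\,dz$ equals $g(t)$ if $t<x$ and $0$ if $t>x$. Notion of solution: write $\hat p_k(s,t)=\int_0^\infty e^{-sx}p_k(x,t)\,dx$ for the Laplace transform in $x$ (so $\hat p_k(0,t)=\int_0^\infty p_k(x,t)\,dx$), with the rule that the transform of $\partial p_k/\partial x$ is $s\hat p_k(s,t)-p_k(0,t)$, where $p_k(0,t)$ is given by the boundary conditions. A time-dependent solution is a pair $(p_0,p_1)$ of generalized functions of $x\in[0,\infty)$, depending on $t$, whose transforms exist for $\Re s\ge 0$ and satisfy $$\frac{\partial\hat p_0(s,t)}{\partial t}=-(\lambda+\mu+s)\hat p_0(s,t)+\delta(t)+\eta\,\hat p_1(0,t),\qquad \hat p_0(s,0)=1,$$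 $$\frac{\partial\hat p_1(s,t)}{\partial t}=-(\eta+s)\hat p_1(s,t)+\lambda\,\hat p_0(0,t),\qquad \hat p_1(s,0)=0,$$ understood in the integrated (variation-of-constants) sense in $t$ with the delta convention above; thus the unit mass from the initial condition and the unit mass from $\delta(t)$ in the boundary condition both contribute. *)

theory Defs
  imports "HOL-Probability.Giry_Monad"
begin

text \<open>
  Generalized functions on \<open>[0,\<infinity>)\<close> are distributions: continuous linear functionals on the
  complex-valued, compactly supported functions that are smooth on \<open>[0,\<infinity>)\<close>, with one-sided
  derivatives at the endpoint. No condition is imposed on the test functions at \<open>0\<close>, so these
  are the distributions on the real line supported in \<open>[0,\<infinity>)\<close>, and a point mass at \<open>0\<close> counts
  in full.
\<close>

definition nderiv :: "nat \<Rightarrow> (real \<Rightarrow> complex) \<Rightarrow> real \<Rightarrow> complex" where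
  "nderiv k f = ((\<lambda>g x. vector_derivative g (at x within {0..})) ^^ k) f"

definition smooth_halfline :: "(real \<Rightarrow> complex) \<Rightarrow> bool" where
  "smooth_halfline f \<longleftrightarrow> (\<forall>k. \<forall>x\<ge>0. nderiv k f differentiable (at x within {0..}))"

definition test_fun :: "(real \<Rightarrow> complex) \<Rightarrow> bool" where
  "test_fun \<phi> \<longleftrightarrow> smooth_halfline \<phi> \<and> (\<exists>R. \<forall>x>R. \<phi> x = 0)"

definition test_converges :: "(nat \<Rightarrow> real \<Rightarrow> complex) \<Rightarrow> (real \<Rightarrow> complex) \<Rightarrow> bool" where
  "test_converges \<phi>s \<phi> \<longleftrightarrow>
     (\<exists>R. \<forall>n. \<forall>x>R. \<phi>s n x = 0) \<and>
     (\<forall>k. uniform_limit {0..} (\<lambda>n. nderiv k (\<phi>s n)) (nderiv k \<phi>) sequentially)"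

type_synonym functional = "(real \<Rightarrow> complex) \<Rightarrow> complex"

text \<open>
  Values of a test function at negative arguments are irrelevant: the continuity clause,
  applied to a constant sequence, forces equal values on test functions that agree on
  \<open>[0,\<infinity>)\<close>.
\<close>

definition generalized_function :: "functional \<Rightarrow> bool" where
  "generalized_function T \<longleftrightarrow>
     (\<forall>\<phi> \<psi>. test_fun \<phi> \<longrightarrow> test_fun \<psi> \<longrightarrow> T (\<lambda>x. \<phi> x + \<psi> x) = T \<phi> + T \<psi>) \<and>
     (\<forall>c \<phi>. test_fun \<phi> \<longrightarrow> T (\<lambda>x. c * \<phi> x) = c * T \<phi>) \<and>
     (\<forall>\<phi>s \<phi>. (\<forall>n. test_fun (\<phi>s n)) \<longrightarrow> test_fun \<phi> \<longrightarrow> test_converges \<phi>s \<phi> \<longrightarrow>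
        (\<lambda>n. T (\<phi>s n)) \<longlonglongrightarrow> T \<phi>)"

definition gf_eq :: "functional \<Rightarrow> functional \<Rightarrow> bool" where
  "gf_eq S T \<longleftrightarrow> (\<forall>\<phi>. test_fun \<phi> \<longrightarrow> S \<phi> = T \<phi>)"

definition gf_delta :: "real \<Rightarrow> functional" where
  "gf_delta c \<phi> = \<phi> c"

definition gf_of_fun :: "(real \<Rightarrow> complex) \<Rightarrow> functional" where
  "gf_of_fun f \<phi> = (LINT x:{0..}|lborel. f x * \<phi> x)"

text \<open>
  \<open>delta_integral c b g\<close> is the integral of \<open>g(z) \<delta>(z - c)\<close> over \<open>0 \<le> z \<le> b\<close>, the delta being
  the Dirac measure at \<open>c\<close>.
\<close>

definition delta_integral ::
    "real \<Rightarrow> real \<Rightarrow> (real \<Rightarrow> 'a::{banach, second_countable_topology}) \<Rightarrow> 'a" where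
  "delta_integral c b g = (LINT z:{0..b}|return borel c. g z)"

text \<open>
  The integral of \<open>e\<^sup>-\<^sup>s\<^sup>x T(x)\<close> over \<open>[0,\<infinity>)\<close> is taken in the sense of integrable distributions:
  it is the common limit of the pairings with \<open>\<psi>\<^sub>n(x) e\<^sup>-\<^sup>s\<^sup>x\<close> along all approximate units, that is,
  sequences of test functions \<open>\<psi>\<^sub>n\<close> whose derivatives of each order are uniformly bounded and
  which converge to \<open>1\<close>, with all derivatives, locally uniformly.
\<close>

definition approx_unit :: "(nat \<Rightarrow> real \<Rightarrow> complex) \<Rightarrow> bool" where
  "approx_unit \<psi> \<longleftrightarrow>
     (\<forall>n. test_fun (\<psi> n)) \<and>
     (\<forall>k. \<exists>C. \<forall>n. \<forall>x\<ge>0. norm (nderiv k (\<psi> n) x) \<le> C) \<and>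
     (\<forall>k R. uniform_limit {0..R} (\<lambda>n. nderiv k (\<psi> n)) (nderiv k (\<lambda>_. 1)) sequentially)"

definition has_laplace :: "functional \<Rightarrow> complex \<Rightarrow> complex \<Rightarrow> bool" where
  "has_laplace T s L \<longleftrightarrow>
     (\<forall>\<psi>. approx_unit \<psi> \<longrightarrow> (\<lambda>n. T (\<lambda>x. \<psi> n x * exp (- s * of_real x))) \<longlonglongrightarrow> L)"

definition laplace_exists :: "functional \<Rightarrow> complex \<Rightarrow> bool" where
  "laplace_exists T s \<longleftrightarrow> (\<exists>L. has_laplace T s L)"

definition laplace :: "functional \<Rightarrow> complex \<Rightarrow> complex" where
  "laplace T s = (THE L. has_laplace T s L)"

text \<open>
  A solution is a pair of families, indexed by \<open>t \<ge> 0\<close>, whose transforms solve, for \<open>Re s \<ge> 0\<close>,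
  \<open>\<partial>\<^sub>t P\<^sub>0(s,t) = -(\<lambda> + \<mu> + s) P\<^sub>0(s,t) + \<delta>(t) + \<eta> P\<^sub>1(0,t)\<close>, \<open>P\<^sub>0(s,0) = 1\<close>, and
  \<open>\<partial>\<^sub>t P\<^sub>1(s,t) = -(\<eta> + s) P\<^sub>1(s,t) + \<lambda> P\<^sub>0(0,t)\<close>, \<open>P\<^sub>1(s,0) = 0\<close>,
  in variation-of-constants form. The first equation has two unit sources at time \<open>0\<close>, the
  initial value and the \<open>\<delta>(t)\<close> of the boundary condition; the latter acts only for \<open>t > 0\<close>.
\<close>

definition time_dependent_solution ::
    "real \<Rightarrow> real \<Rightarrow> real \<Rightarrow> (real \<Rightarrow> functional) \<Rightarrow> (real \<Rightarrow> functional) \<Rightarrow> bool" where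
  "time_dependent_solution lam mu eta p0 p1 \<longleftrightarrow>
     (\<forall>t\<ge>0. generalized_function (p0 t) \<and> generalized_function (p1 t)) \<and>
     (\<forall>t\<ge>0. \<forall>s. Re s \<ge> 0 \<longrightarrow> laplace_exists (p0 t) s \<and> laplace_exists (p1 t) s) \<and>
     (\<forall>s. Re s \<ge> 0 \<longrightarrow> laplace (p0 0) s = 1 \<and> laplace (p1 0) s = 0) \<and>
     (\<forall>t>0. set_integrable lborel {0..t} (\<lambda>u. laplace (p0 u) 0) \<and>
            set_integrable lborel {0..t} (\<lambda>u. laplace (p1 u) 0)) \<and>
     (\<forall>t>0. \<forall>s. Re s \<ge> 0 \<longrightarrow>
        laplace (p0 t) s =
          exp (- (of_real (lam + mu) + s) * of_real t) * laplace (p0 0) s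
          + delta_integral 0 t (\<lambda>u. exp (- (of_real (lam + mu) + s) * of_real (t - u)))
          + (LINT u:{0..t}|lborel. exp (- (of_real (lam + mu) + s) * of_real (t - u))
                                     * (of_real eta * laplace (p1 u) 0)) \<and>
        laplace (p1 t) s =
          exp (- (of_real eta + s) * of_real t) * laplace (p1 0) s
          + (LINT u:{0..t}|lborel. exp (- (of_real eta + s) * of_real (t - u))
                                     * (of_real lam * laplace (p0 u) 0)))"

text \<open>
  Here \<open>D\<close> is the weak derivative of \<open>p\<close> with respect to \<open>t\<close>. The time \<open>t = 0\<close> is excluded
  because of the jump caused by the \<open>\<delta>(t)\<close> in the boundary condition.
\<close>

definition derivative_commutes_with_laplace :: "(real \<Rightarrow> functional) \<Rightarrow> bool" where
  "derivative_commutes_with_laplace p \<longleftrightarrow>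
     (\<forall>t>0. \<exists>D. generalized_function D \<and>
        (\<forall>\<phi>. test_fun \<phi> \<longrightarrow> ((\<lambda>u. p u \<phi>) has_vector_derivative D \<phi>) (at t)) \<and>
        (\<forall>s. Re s \<ge> 0 \<longrightarrow> laplace_exists D s \<and>
           ((\<lambda>u. laplace (p u) s) has_vector_derivative laplace D s) (at t)))"

text \<open>
  A generalized function has a value at a point near which it is given by a continuous
  function; thus \<open>\<delta>(x - t)\<close> has the value \<open>0\<close> at every \<open>x \<noteq> t\<close> and no value at \<open>x = t\<close>.
\<close>

definition has_value_at :: "functional \<Rightarrow> real \<Rightarrow> complex \<Rightarrow> bool" where
  "has_value_at T x v \<longleftrightarrow>
     (\<exists>e>0. \<exists>f. continuous_on ({0..} \<inter> cball x e) f \<and> f x = v \<and>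
        (\<forall>\<phi>. test_fun \<phi> \<longrightarrow> (\<forall>y\<ge>0. \<bar>y - x\<bar> \<ge> e \<longrightarrow> \<phi> y = 0) \<longrightarrow> T \<phi> = gf_of_fun f \<phi>))"

definition pointwise_limit :: "(real \<Rightarrow> functional) \<Rightarrow> real \<Rightarrow> complex \<Rightarrow> bool" where
  "pointwise_limit p x L \<longleftrightarrow>
     (\<exists>v. (\<forall>\<^sub>F t in at_top. has_value_at (p t) x (v t)) \<and> (v \<longlongrightarrow> L) at_top)"

end

(*
  At s = 0 the transformed system is a closed linear Volterra system for the total masses
  P0 and P1, whose matrix has the eigenvalues z1 and z2; so P0 = l1 e^(z1 t) + l2 e^(z2 t) and
  P1 = h1 e^(z1 t) + h2 e^(z2 t), and the variation-of-constants formula then gives the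
  transforms for all s. Inverting them, p0 is 2 e^(-(lam+mu) t) delta(x-t) plus the density
  eta e^(-(lam+mu) x) P1(t-x) on x < t, and p1 has the density lam e^(-eta x) P0(t-x) on x < t.

  Uniqueness needs the injectivity of the transform on generalized functions T for which the
  limit along all approximate units exists. Existence at s = 0 already bounds T phi by a C^k norm
  of phi. A test function is a smooth function of y = e^(-x), so by Weierstrass it is a limit in
  C^k of polynomials in e^(-x). Hence T is determined by its transform at s = 0, 1, 2, ...
*)
theory Submission
  imports Defs
begin

section \<open>Iterated one-sided derivatives\<close>

text \<open>Test functions are smooth up to the endpoint 0, so every derivative is one-sided there.
  In y = e^(-x) they live on (0,1] and vanish near y = 0, which makes approximation on the closed
  interval [0,1] possible. A generalized function comes with no order or growth bound: finite order
  has to be extracted from the demand that all approximate units give one limit, and that demand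
  says nothing until an approximate unit has been constructed. Exponentials are not test functions,
  so they enter multiplied by cutoffs.

  The constant 2 is the initial unit mass plus the unit mass of \<delta>(t). The transform of
  \<open>p0\<close> is therefore 1 at time 0 but has right limit 2, and facts about it are stated
  for t > 0 or up to one point.

  The long formulas collapse: for x < t the sums l1 + l2 = 2 and h1 + h2 = 0 remove the terms
  foreign to the density, and for x \<ge> t the integrals against \<delta>(z - t) cancel the
  rest.\<close>

lemma nderiv_0 [simp]: "nderiv 0 f = f"
  by (simp add: nderiv_def)

lemma nderiv_Suc: "nderiv (Suc k) f x = vector_derivative (nderiv k f) (at x within {0..})"
  by (simp add: nderiv_def)

text \<open>Every point of the half-line, the endpoint included, is a limit point of it; this makes
  one-sided derivatives unique, so that \<open>vector_derivative\<close> can be evaluated.\<close>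

lemma at_within_halfline_neq_bot: "at x within {0..} \<noteq> bot" if "x \<ge> 0" for x :: real
proof -
  have "x islimpt {x..x+1}" by (simp add: islimpt_Icc)
  then have "x islimpt {0..}" by (rule islimpt_subset) (use that in auto)
  then show ?thesis by (simp add: trivial_limit_within)
qed

lemma has_vector_derivative_nderiv:
  assumes "smooth_halfline f" "x \<ge> 0"
  shows "(nderiv k f has_vector_derivative nderiv (Suc k) f x) (at x within {0..})"
  using assms vector_derivative_works unfolding smooth_halfline_def nderiv_Suc by blast

text \<open>Guessing a chain \<open>F\<close> in which each member differentiates to the next
  replaces any unfolding of the iteration. Agreement is confined to the half-line because values at
  negative arguments are arbitrary.\<close>

lemma nderiv_eqI:
  assumes "\<And>x. x \<ge> 0 \<Longrightarrow> f x = F 0 x"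
    and F: "\<And>k x. x \<ge> 0 \<Longrightarrow> (F k has_vector_derivative F (Suc k) x) (at x within {0..})"
  shows "x \<ge> 0 \<Longrightarrow> nderiv k f x = F k x"
proof (induction k arbitrary: x)
  case 0
  then show ?case using assms(1) by simp
next
  case (Suc k)
  have "(nderiv k f has_vector_derivative F (Suc k) x) (at x within {0..})"
    by (rule has_vector_derivative_transform[OF _ _ F]) (use Suc in auto)
  then show ?case
    unfolding nderiv_Suc
    using vector_derivative_within at_within_halfline_neq_bot Suc.prems by blast
qed

lemma smooth_halflineI:
  assumes "\<And>x. x \<ge> 0 \<Longrightarrow> f x = F 0 x"
    and F: "\<And>k x. x \<ge> 0 \<Longrightarrow> (F k has_vector_derivative F (Suc k) x) (at x within {0..})"
  shows "smooth_halfline f"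
  unfolding smooth_halfline_def
proof (intro allI impI)
  fix k and x :: real assume "x \<ge> 0"
  have "(nderiv k f has_vector_derivative F (Suc k) x) (at x within {0..})"
    by (rule has_vector_derivative_transform[OF _ _ F])
      (use \<open>x \<ge> 0\<close> nderiv_eqI[of f F, OF assms] in auto)
  then show "nderiv k f differentiable at x within {0..}"
    by (rule differentiableI_vector)
qed

lemma continuous_on_nderiv:
  assumes "smooth_halfline f" shows "continuous_on {0..} (nderiv k f)"
  using has_vector_derivative_nderiv[OF assms]
  by (auto simp: continuous_on_eq_continuous_within intro!: has_vector_derivative_continuous)

lemma continuous_on_smooth_halfline:
  "smooth_halfline f \<Longrightarrow> continuous_on {0..} f"
  using continuous_on_nderiv[of f 0] by simp

context
  fixes f g :: "real \<Rightarrow> complex"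
  assumes f: "smooth_halfline f" and g: "smooth_halfline g"
begin

lemma has_vector_derivative_nderiv_add:
  "x \<ge> 0 \<Longrightarrow> ((\<lambda>x. nderiv k f x + nderiv k g x) has_vector_derivative
     nderiv (Suc k) f x + nderiv (Suc k) g x) (at x within {0..})"
  by (intro has_vector_derivative_add has_vector_derivative_nderiv f g)

lemma smooth_halfline_add: "smooth_halfline (\<lambda>x. f x + g x)"
  by (rule smooth_halflineI[where F="\<lambda>k x. nderiv k f x + nderiv k g x"])
    (simp_all add: has_vector_derivative_nderiv_add)

lemma nderiv_add: "x \<ge> 0 \<Longrightarrow> nderiv k (\<lambda>x. f x + g x) x = nderiv k f x + nderiv k g x"
  by (rule nderiv_eqI[where F="\<lambda>k x. nderiv k f x + nderiv k g x"])
    (simp_all add: has_vector_derivative_nderiv_add)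

text \<open>Inductive step of the Leibniz rule, in the chain form that \<open>nderiv_eqI\<close>
  consumes; the binomials recombine by Pascal's rule.\<close>

lemma has_vector_derivative_nderiv_mult:
  assumes "x \<ge> 0"
  shows "((\<lambda>x. \<Sum>i\<le>k. of_nat (k choose i) * nderiv i f x * nderiv (k - i) g x)
    has_vector_derivative
      (\<Sum>i\<le>Suc k. of_nat (Suc k choose i) * nderiv i f x * nderiv (Suc k - i) g x))
    (at x within {0..})"
proof -
  let ?F = "\<lambda>i. nderiv i f x" and ?G = "\<lambda>i. nderiv i g x"
  have *: "((\<lambda>x. \<Sum>i\<le>k. of_nat (k choose i) * (nderiv i f x * nderiv (k - i) g x))
    has_vector_derivative
      (\<Sum>i\<le>k. of_nat (k choose i) * (?F i * ?G (Suc (k - i)) + ?F (Suc i) * ?G (k - i))))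
    (at x within {0..})"
    by (intro has_vector_derivative_sum has_vector_derivative_mult_right
        has_vector_derivative_mult has_vector_derivative_nderiv f g assms)
  have "(\<Sum>i\<le>Suc k. of_nat (Suc k choose i) * ?F i * ?G (Suc k - i)) =
      ?F 0 * ?G (Suc k) + (\<Sum>i\<le>k. of_nat (k choose i) * (?F (Suc i) * ?G (k - i)))
      + (\<Sum>i\<le>k. of_nat (k choose Suc i) * (?F (Suc i) * ?G (k - i)))"
    by (subst sum.atMost_Suc_shift) (simp add: sum.distrib algebra_simps)
  \<comment> \<open>Shifting the index back merges two of the three pieces into one sum. Its last
    term, i = k + 1, vanishes with the binomial coefficient k choose (k + 1).\<close>
  also have "?F 0 * ?G (Suc k) + (\<Sum>i\<le>k. of_nat (k choose Suc i) * (?F (Suc i) * ?G (k - i)))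
      = (\<Sum>i\<le>Suc k. of_nat (k choose i) * (?F i * ?G (Suc k - i)))"
    by (subst sum.atMost_Suc_shift) simp
  then have "?F 0 * ?G (Suc k) + (\<Sum>i\<le>k. of_nat (k choose i) * (?F (Suc i) * ?G (k - i)))
      + (\<Sum>i\<le>k. of_nat (k choose Suc i) * (?F (Suc i) * ?G (k - i)))
      = (\<Sum>i\<le>k. of_nat (k choose i) * (?F (Suc i) * ?G (k - i)))
       + (\<Sum>i\<le>k. of_nat (k choose i) * (?F i * ?G (Suc k - i)))"
    by (simp add: algebra_simps)
  also have "\<dots> = (\<Sum>i\<le>k. of_nat (k choose i) * (?F i * ?G (Suc (k - i)) + ?F (Suc i) * ?G (k - i)))"
    by (auto simp: sum.distrib[symmetric] algebra_simps Suc_diff_le intro!: sum.cong)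
  finally show ?thesis using * by (simp add: mult.assoc)
qed

lemma smooth_halfline_mult: "smooth_halfline (\<lambda>x. f x * g x)"
  by (rule smooth_halflineI[where
      F="\<lambda>k x. \<Sum>i\<le>k. of_nat (k choose i) * nderiv i f x * nderiv (k - i) g x", OF _ has_vector_derivative_nderiv_mult])
    simp_all

lemma nderiv_mult:
  "x \<ge> 0 \<Longrightarrow> nderiv k (\<lambda>x. f x * g x) x =
     (\<Sum>i\<le>k. of_nat (k choose i) * nderiv i f x * nderiv (k - i) g x)"
  by (rule nderiv_eqI[where
      F="\<lambda>k x. \<Sum>i\<le>k. of_nat (k choose i) * nderiv i f x * nderiv (k - i) g x", OF _ has_vector_derivative_nderiv_mult])
    simp_all

end

lemma smooth_halfline_const: "smooth_halfline (\<lambda>_. c)"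
  by (rule smooth_halflineI[where F="\<lambda>k x. if k = 0 then c else 0"]) simp_all

lemma nderiv_const: "x \<ge> 0 \<Longrightarrow> nderiv k (\<lambda>_. c) x = (if k = 0 then c else 0)"
  by (rule nderiv_eqI[where F="\<lambda>k x. if k = 0 then c else 0"]) simp_all

lemma smooth_halfline_cmult:
  "smooth_halfline f \<Longrightarrow> smooth_halfline (\<lambda>x. c * f x)"
  by (rule smooth_halfline_mult[OF smooth_halfline_const])

lemma nderiv_cmult:
  assumes "smooth_halfline f" "x \<ge> 0"
  shows "nderiv k (\<lambda>x. c * f x) x = c * nderiv k f x"
proof (rule nderiv_eqI[where F="\<lambda>k x. c * nderiv k f x", OF _ _ assms(2)])
  fix k and x :: real assume "x \<ge> 0"
  then show "((\<lambda>x. c * nderiv k f x) has_vector_derivative c * nderiv (Suc k) f x)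
      (at x within {0..})"
    by (intro has_vector_derivative_mult_right has_vector_derivative_nderiv assms)
qed simp

lemma smooth_halfline_diff:
  "smooth_halfline f \<Longrightarrow> smooth_halfline g \<Longrightarrow> smooth_halfline (\<lambda>x. f x - g x)"
  using smooth_halfline_add[OF _ smooth_halfline_cmult[of g "-1"], of f] by simp

text \<open>The definition adds each new derivative on the outside; an induction that passes from a
  function to its derivative needs it on the inside.\<close>

lemma nderiv_Suc_shift: "nderiv (Suc k) f = nderiv k (nderiv 1 f)"
  by (simp only: nderiv_def funpow_Suc_right o_apply) simp

lemma smooth_halfline_nderiv1: "smooth_halfline f \<Longrightarrow> smooth_halfline (nderiv 1 f)"
  unfolding smooth_halfline_def by (metis nderiv_Suc_shift)

lemma smooth_halfline_exp: "smooth_halfline (\<lambda>x. exp (c * of_real x))"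
proof (rule smooth_halflineI[where F="\<lambda>k x. c ^ k * exp (c * of_real x)"])
  show "((\<lambda>x. c ^ k * exp (c * of_real x)) has_vector_derivative c ^ Suc k * exp (c * of_real x))
     (at x within {0..})" for k and x :: real
    by (rule has_vector_derivative_real_field) (auto intro!: derivative_eq_intros)
qed simp

lemma nderiv_exp:
  "x \<ge> 0 \<Longrightarrow> nderiv k (\<lambda>x. exp (c * of_real x)) x = c ^ k * exp (c * of_real x)"
proof (rule nderiv_eqI[where F="\<lambda>k x. c ^ k * exp (c * of_real x)"])
  show "((\<lambda>x. c ^ k * exp (c * of_real x)) has_vector_derivative c ^ Suc k * exp (c * of_real x))
     (at x within {0..})" for k and x :: real
    by (rule has_vector_derivative_real_field) (auto intro!: derivative_eq_intros)
qed simp_all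

lemma smooth_halfline_sum:
  "finite A \<Longrightarrow> (\<And>i. i \<in> A \<Longrightarrow> smooth_halfline (f i)) \<Longrightarrow> smooth_halfline (\<lambda>x. \<Sum>i\<in>A. f i x)"
  by (induction A rule: finite_induct) (simp_all add: smooth_halfline_add smooth_halfline_const)

section \<open>Test functions\<close>

lemma nderiv_eq_0_beyond:
  assumes "\<And>x. x > R \<Longrightarrow> f x = 0" "x > R" "x \<ge> 0"
  shows "nderiv k f x = 0"
  using assms(2,3)
proof (induction k arbitrary: x)
  case 0
  then show ?case using assms(1) by simp
next
  case (Suc k)
  have "(nderiv k f has_vector_derivative 0) (at x within {0..})"
    by (rule has_vector_derivative_transform_within[of "\<lambda>_. 0" _ _ _ "x - R"])
      (use Suc in \<open>auto simp: dist_real_def\<close>)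
  then show ?case
    unfolding nderiv_Suc
    using vector_derivative_within at_within_halfline_neq_bot Suc.prems by blast
qed

lemma test_funD: "test_fun \<phi> \<Longrightarrow> smooth_halfline \<phi>"
  by (simp add: test_fun_def)

lemma test_fun_support:
  assumes "test_fun \<phi>" obtains R where "R \<ge> 0" "\<forall>x>R. \<phi> x = 0"
proof -
  obtain R where "\<forall>x>R. \<phi> x = 0" using assms by (auto simp: test_fun_def)
  then show ?thesis by (intro that[of "max R 0"]) auto
qed

lemma test_funI:
  "smooth_halfline \<phi> \<Longrightarrow> (\<And>x. x > R \<Longrightarrow> \<phi> x = 0) \<Longrightarrow> test_fun \<phi>"
  by (auto simp: test_fun_def)

lemma test_fun_mult:
  assumes "test_fun \<phi>" "smooth_halfline f" shows "test_fun (\<lambda>x. \<phi> x * f x)"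
proof -
  obtain R where "\<forall>x>R. \<phi> x = 0"
    using test_fun_support[OF assms(1)] by blast
  then show ?thesis
    by (intro test_funI[where R=R, OF smooth_halfline_mult[OF test_funD[OF assms(1)] assms(2)]]) auto
qed

lemma test_fun_cmult: "test_fun \<phi> \<Longrightarrow> test_fun (\<lambda>x. c * \<phi> x)"
  using test_fun_mult[OF _ smooth_halfline_const, of \<phi> c] by (simp add: mult.commute)

lemma test_fun_add:
  assumes "test_fun \<phi>" "test_fun \<psi>" shows "test_fun (\<lambda>x. \<phi> x + \<psi> x)"
proof -
  obtain R where "\<forall>x>R. \<phi> x = 0"
    using test_fun_support[OF assms(1)] by blast
  moreover obtain S where "\<forall>x>S. \<psi> x = 0"
    using test_fun_support[OF assms(2)] by blast
  ultimately show ?thesis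
    by (intro test_funI[where R="max R S", OF smooth_halfline_add[OF assms[THEN test_funD]]]) auto
qed

lemma test_fun_sum:
  "finite A \<Longrightarrow> (\<And>i. i \<in> A \<Longrightarrow> test_fun (f i)) \<Longrightarrow> test_fun (\<lambda>x. \<Sum>i\<in>A. f i x)"
  by (induction A rule: finite_induct)
    (simp_all add: test_fun_add test_funI[OF smooth_halfline_const])

lemma test_fun_nderiv1:
  assumes "test_fun \<phi>" shows "test_fun (nderiv 1 \<phi>)"
proof -
  obtain R where R: "R \<ge> 0" "\<forall>x>R. \<phi> x = 0"
    using test_fun_support[OF assms] by blast
  then show ?thesis
    by (intro test_funI[where R=R, OF smooth_halfline_nderiv1[OF test_funD[OF assms]]]
        nderiv_eq_0_beyond[of R \<phi>]) auto
qed

lemma nderiv_test_fun_bounded: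
  assumes "test_fun \<phi>" shows "\<exists>C. \<forall>x\<ge>0. norm (nderiv k \<phi> x) \<le> C"
proof -
  obtain R where R: "R \<ge> 0" "\<forall>x>R. \<phi> x = 0"
    using test_fun_support[OF assms] by blast
  have "compact (nderiv k \<phi> ` {0..R})"
    by (rule compact_continuous_image[OF continuous_on_subset[OF
        continuous_on_nderiv[OF test_funD[OF assms]]]]) auto
  then obtain C where C: "\<forall>x\<in>{0..R}. norm (nderiv k \<phi> x) \<le> C"
    using compact_imp_bounded bounded_iff by (metis imageI)
  have "norm (nderiv k \<phi> x) \<le> max C 0" if "x \<ge> 0" for x
    using C nderiv_eq_0_beyond[of R \<phi> x k, OF R(2)[rule_format]] that by (cases "x \<le> R") (auto simp: le_max_iff_disj)
  then show ?thesis by blast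
qed

section \<open>\<open>C\<^sup>k\<close> bounds\<close>

text \<open>The C^k norm enters only through upper bounds, so it is encoded as a relation and no
  supremum has to be shown finite.\<close>

definition ck_bound :: "nat \<Rightarrow> real \<Rightarrow> (real \<Rightarrow> complex) \<Rightarrow> bool" where
  "ck_bound k B f \<longleftrightarrow> (\<forall>j\<le>k. \<forall>x\<ge>0. norm (nderiv j f x) \<le> B)"

lemma ck_boundD: "ck_bound k B f \<Longrightarrow> j \<le> k \<Longrightarrow> x \<ge> 0 \<Longrightarrow> norm (nderiv j f x) \<le> B"
  by (simp add: ck_bound_def)

lemma ck_bound_nonneg: "ck_bound k B f \<Longrightarrow> 0 \<le> B"
  using ck_boundD[of k B f 0 0] norm_ge_zero order_trans by blast

text \<open>The factor 2^k is the sum of a row of binomial coefficients in the Leibniz rule.\<close>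

lemma ck_bound_mult:
  assumes "smooth_halfline f" "smooth_halfline g" "ck_bound k A f" "ck_bound k B g"
  shows "ck_bound k (2 ^ k * A * B) (\<lambda>x. f x * g x)"
  unfolding ck_bound_def
proof (intro allI impI)
  fix j and x :: real assume j: "j \<le> k" and x: "0 \<le> x"
  have A: "A \<ge> 0" and B: "B \<ge> 0" using ck_bound_nonneg assms by auto
  have "norm (nderiv j (\<lambda>x. f x * g x) x) \<le>
      (\<Sum>i\<le>j. norm (of_nat (j choose i) * nderiv i f x * nderiv (j - i) g x))"
    unfolding nderiv_mult[OF assms(1,2) x] by (rule norm_sum)
  also have "\<dots> \<le> (\<Sum>i\<le>j. of_nat (j choose i) * A * B)"
    using ck_boundD[OF assms(3)] ck_boundD[OF assms(4)] j x A B
    by (intro sum_mono) (auto simp: norm_mult intro!: mult_mono)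
  also have "\<dots> = 2 ^ j * A * B"
    by (simp add: sum_distrib_right[symmetric] of_nat_sum[symmetric] choose_row_sum del: of_nat_sum)
  also have "\<dots> \<le> 2 ^ k * A * B"
    using j A B by (intro mult_right_mono power_increasing) auto
  finally show "norm (nderiv j (\<lambda>x. f x * g x) x) \<le> 2 ^ k * A * B" .
qed

lemma ck_bound_cmult:
  assumes "smooth_halfline f" "ck_bound k B f"
  shows "ck_bound k (norm c * B) (\<lambda>x. c * f x)"
  using assms by (auto simp: ck_bound_def nderiv_cmult norm_mult intro!: mult_left_mono)

text \<open>On a compact interval the derivatives of the limit and of the fixed factor are bounded,
  so the products in the Leibniz rule converge uniformly again.\<close>

lemma uniform_limit_nderiv_mult:
  assumes "\<And>n. smooth_halfline (f n)" "smooth_halfline F" "smooth_halfline g"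
    and "\<And>k. uniform_limit {0..R} (\<lambda>n. nderiv k (f n)) (nderiv k F) sequentially"
  shows "uniform_limit {0..R} (\<lambda>n. nderiv k (\<lambda>x. f n x * g x)) (nderiv k (\<lambda>x. F x * g x)) sequentially"
proof -
  have bd: "bounded (nderiv j h ` {0..R})" if "smooth_halfline h" for j h
    by (intro compact_imp_bounded compact_continuous_image
        continuous_on_subset[OF continuous_on_nderiv[OF that]]) auto
  have sum: "uniform_limit S (\<lambda>n x. \<Sum>i\<in>I. u i n x) (\<lambda>x. \<Sum>i\<in>I. v i x) sequentially"
    if "finite I" "\<And>i. i \<in> I \<Longrightarrow> uniform_limit S (u i) (v i) sequentially"
    for S and I :: "nat set" and u :: "nat \<Rightarrow> nat \<Rightarrow> real \<Rightarrow> complex" and v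
    using that
    by (induction I rule: finite_induct) (auto intro!: uniform_limit_add uniform_limit_const)
  have "uniform_limit {0..R}
     (\<lambda>n x. \<Sum>i\<le>k. of_nat (k choose i) * nderiv i (f n) x * nderiv (k - i) g x)
     (\<lambda>x. \<Sum>i\<le>k. of_nat (k choose i) * nderiv i F x * nderiv (k - i) g x) sequentially"
    unfolding mult.assoc
    by (intro sum finite_atMost bounded_linear.uniform_limit[OF bounded_linear_mult_right]
        bounded_bilinear.bounded_uniform_limit[OF bounded_bilinear_mult] assms bd
        uniform_limit_const)
  then show ?thesis
    by (rule uniform_limit_cong'[THEN iffD1, rotated 2])
      (auto simp: nderiv_mult assms)
qed

section \<open>Existence of approximate units\<close>

text \<open>The flat function e^(-1/x) with a polynomial in 1/x as a parameter: unlike e^(-1/x)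
  alone, this family is closed under differentiation.\<close>

definition flat_exp :: "real poly \<Rightarrow> real \<Rightarrow> real" where
  "flat_exp p x = (if x > 0 then poly p (1 / x) * exp (- 1 / x) else 0)"

text \<open>With y = 1/x, so that dy/dx = -y^2, the derivative of p(y) e^(-y) in x is (p(y) - p'(y))
  y^2 e^(-y).\<close>

definition flat_exp_deriv :: "real poly \<Rightarrow> real poly" where
  "flat_exp_deriv p = (p - pderiv p) * [:0, 0, 1:]"

lemma poly_times_exp_minus_tendsto_0:
  "((\<lambda>y::real. poly p y * exp (- y)) \<longlongrightarrow> 0) at_top"
proof -
  have "((\<lambda>y. \<Sum>i\<le>degree p. coeff p i * (y ^ i / exp y)) \<longlongrightarrow> 0) at_top"
    by (intro tendsto_null_sum tendsto_mult_right_zero tendsto_power_div_exp_0)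
  then show ?thesis
    by (simp add: poly_altdef sum_distrib_right exp_minus divide_inverse mult.assoc)
qed

lemma has_real_derivative_flat_exp:
  "(flat_exp p has_real_derivative flat_exp (flat_exp_deriv p) x) (at x)"
proof (cases x "0 :: real" rule: linorder_cases)
  case less
  have "((\<lambda>_. 0) has_real_derivative flat_exp (flat_exp_deriv p) x) (at x)"
    using less by (simp add: flat_exp_def)
  then show ?thesis
    by (rule has_field_derivative_transform_within_open[where S="{..<0}"])
      (use less in \<open>auto simp: flat_exp_def\<close>)
next
  case greater
  have "((\<lambda>x. poly p (1 / x) * exp (- 1 / x)) has_real_derivative flat_exp (flat_exp_deriv p) x) (at x)"
    using greater
    by (auto intro!: derivative_eq_intros DERIV_chain2[OF poly_DERIV]
        simp: flat_exp_def flat_exp_deriv_def field_simps power2_eq_square)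
  then show ?thesis
    by (rule has_field_derivative_transform_within_open[where S="{0<..}"])
      (use greater in \<open>auto simp: flat_exp_def\<close>)
next
  case equal
  have "((\<lambda>h. flat_exp p h / h) \<longlongrightarrow> 0) (at_right 0)"
  proof (rule Lim_transform_eventually)
    \<comment> \<open>Dividing by h multiplies by y = 1/h, so the quotient is y p(y) e^(-y), which
      tends to 0 as y grows.\<close>
    show "((\<lambda>h. poly (p * [:0, 1:]) (inverse h) * exp (- inverse h)) \<longlongrightarrow> 0) (at_right (0 :: real))"
      by (rule filterlim_compose[OF poly_times_exp_minus_tendsto_0 filterlim_inverse_at_top_right])
    show "\<forall>\<^sub>F h in at_right 0. poly (p * [:0, 1:]) (inverse h) * exp (- inverse h) = flat_exp p h / h"
      unfolding eventually_at_right[OF zero_less_one]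
      by (intro exI[of _ 1]) (auto simp: flat_exp_def field_simps)
  qed
  moreover have "((\<lambda>h. flat_exp p h / h) \<longlongrightarrow> 0) (at_left 0)"
  proof (rule Lim_transform_eventually[OF tendsto_const])
    show "\<forall>\<^sub>F h in at_left 0. 0 = flat_exp p h / h"
      unfolding eventually_at_left[of "- 1" "0 :: real", simplified]
      by (intro exI[of _ "- 1"]) (auto simp: flat_exp_def)
  qed
  ultimately have "((\<lambda>h. flat_exp p h / h) \<longlongrightarrow> 0) (at 0)"
    by (simp add: filterlim_split_at)
  then show ?thesis
    using equal by (simp add: DERIV_def flat_exp_def)
qed

text \<open>The cutoffs evaluate these functions at 1 - x/(n+1) with x \<ge> 0, hence at arguments
  up to 1.\<close>

lemma flat_exp_bounded: "\<exists>C. \<forall>x\<le>1. \<bar>flat_exp p x\<bar> \<le> C"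
proof -
  have "continuous_on {0..1} (flat_exp p)"
    by (rule DERIV_continuous_on) (rule has_field_derivative_at_within[OF has_real_derivative_flat_exp])
  then have "compact (flat_exp p ` {0..1})"
    by (intro compact_continuous_image) auto
  then obtain C where C: "\<forall>x\<in>{0..1}. norm (flat_exp p x) \<le> C"
    using compact_imp_bounded bounded_iff by (metis imageI)
  have "\<bar>flat_exp p x\<bar> \<le> max C 0" if "x \<le> 1" for x
    using C that by (cases "x \<ge> 0") (auto simp: flat_exp_def le_max_iff_disj)
  then show ?thesis by blast
qed

text \<open>
  For \<open>x < n + 1\<close> this is \<open>exp (1 - 1 / (1 - x / (n + 1)))\<close>. No plateau is needed: the rescaling alone
  makes the derivatives tend to \<open>0\<close>.
\<close>

definition cutoff :: "nat \<Rightarrow> real \<Rightarrow> complex" where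
  "cutoff n x = of_real (exp 1 * flat_exp 1 (1 - x / Suc n))"

definition cutoff_deriv :: "nat \<Rightarrow> nat \<Rightarrow> real \<Rightarrow> complex" where
  "cutoff_deriv n k x =
     of_real (exp 1 * (- 1 / Suc n) ^ k * flat_exp ((flat_exp_deriv ^^ k) 1) (1 - x / Suc n))"

lemma cutoff_chain:
  "(cutoff_deriv n k has_vector_derivative cutoff_deriv n (Suc k) x) (at x within {0..})"
proof -
  have "((\<lambda>x. exp 1 * (- 1 / Suc n) ^ k * flat_exp ((flat_exp_deriv ^^ k) 1) (1 - x / Suc n))
    has_real_derivative
    exp 1 * (- 1 / Suc n) ^ k *
      (flat_exp ((flat_exp_deriv ^^ Suc k) 1) (1 - x / Suc n) * (- 1 / Suc n))) (at x within {0..})"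
    unfolding funpow.simps o_apply
    by (rule has_field_derivative_at_within, intro DERIV_cmult DERIV_chain2[OF has_real_derivative_flat_exp])
      (auto intro!: derivative_eq_intros)
  then show ?thesis
    unfolding cutoff_deriv_def
    by (intro has_vector_derivative_of_real)
      (simp add: has_real_derivative_iff_has_vector_derivative mult_ac)
qed

lemma smooth_halfline_cutoff: "smooth_halfline (cutoff n)"
  by (rule smooth_halflineI[where F="cutoff_deriv n", OF _ cutoff_chain]) (simp add: cutoff_def cutoff_deriv_def)

lemma nderiv_cutoff: "x \<ge> 0 \<Longrightarrow> nderiv k (cutoff n) x = cutoff_deriv n k x"
  by (rule nderiv_eqI[where F="cutoff_deriv n", OF _ cutoff_chain]) (simp add: cutoff_def cutoff_deriv_def)

lemma test_fun_cutoff: "test_fun (cutoff n)"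
  by (rule test_funI[OF smooth_halfline_cutoff, of "Suc n"])
    (auto simp: cutoff_def flat_exp_def field_simps)

lemma uniform_limit_sequentiallyI:
  fixes f :: "nat \<Rightarrow> 'a \<Rightarrow> 'b :: real_normed_vector"
  assumes "\<And>n x. x \<in> S \<Longrightarrow> norm (f n x - l x) \<le> K / Suc n"
  shows "uniform_limit S f l sequentially"
proof (rule uniform_limitI)
  fix e :: real assume "e > 0"
  have "(\<lambda>n. K * inverse (Suc n)) \<longlonglongrightarrow> 0"
    by (intro tendsto_mult_right_zero LIMSEQ_inverse_real_of_nat)
  then have "\<forall>\<^sub>F n in sequentially. K / Suc n < e"
    using \<open>e > 0\<close> by (auto simp: divide_inverse dest: order_tendstoD)
  then show "\<forall>\<^sub>F n in sequentially. \<forall>x\<in>S. dist (f n x) (l x) < e"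
    by eventually_elim (use assms le_less_trans in \<open>unfold dist_norm, blast\<close>)
qed

text \<open>Each differentiation brings a factor 1/(n+1), which settles all orders k \<ge> 1. For
  order 0 the mean value theorem applies: on [0,R] the inner argument is within R/(n+1) of 1, where
  the normalised profile equals 1.\<close>

lemma approx_unit_cutoff: "approx_unit cutoff"
  unfolding approx_unit_def
proof (intro conjI allI)
  show "test_fun (cutoff n)" for n by (rule test_fun_cutoff)
next
  fix k
  obtain C where C: "\<And>x. x \<le> 1 \<Longrightarrow> \<bar>flat_exp ((flat_exp_deriv ^^ k) 1) x\<bar> \<le> C"
    using flat_exp_bounded by blast
  have *: "norm (nderiv k (cutoff n) x) \<le> exp 1 * C * (1 / Suc n) ^ k" if "x \<ge> 0" for n x
  proof -
    have "norm (nderiv k (cutoff n) x) =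
        exp 1 * (1 / Suc n) ^ k * \<bar>flat_exp ((flat_exp_deriv ^^ k) 1) (1 - x / Suc n)\<bar>"
      using that
      by (simp add: nderiv_cutoff cutoff_deriv_def norm_mult norm_power abs_mult power_abs norm_divide
          power_divide del: of_nat_Suc)
    also have "\<dots> \<le> exp 1 * (1 / Suc n) ^ k * C"
      using that by (intro mult_left_mono C) auto
    finally show ?thesis by (simp add: mult_ac)
  qed
  have "C \<ge> 0" using C[of 0] by linarith
  show "\<exists>C. \<forall>n. \<forall>x\<ge>0. norm (nderiv k (cutoff n) x) \<le> C"
  proof (intro exI allI impI)
    fix n and x :: real assume "x \<ge> 0"
    have "exp 1 * C * (1 / Suc n) ^ k \<le> exp 1 * C * 1"
      using \<open>C \<ge> 0\<close> by (intro mult_left_mono power_le_one) auto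
    then show "norm (nderiv k (cutoff n) x) \<le> exp 1 * C"
      using *[OF \<open>x \<ge> 0\<close>, of n] by linarith
  qed
  fix R
  show "uniform_limit {0..R} (\<lambda>n. nderiv k (cutoff n)) (nderiv k (\<lambda>_. 1)) sequentially"
  proof (cases k)
    case (Suc j)
    show ?thesis
    proof (rule uniform_limit_sequentiallyI)
      fix n x assume x: "x \<in> {0..R}"
      have "exp 1 * C * (1 / Suc n) ^ k \<le> exp 1 * C * (1 / Suc n)"
        using \<open>C \<ge> 0\<close> Suc by (intro mult_left_mono power_decreasing[of 1 k, simplified]) auto
      then show "norm (nderiv k (cutoff n) x - nderiv k (\<lambda>_. 1) x) \<le> exp 1 * C / Suc n"
        using *[of x n] x Suc by (simp add: nderiv_const)
    qed
  next
    case 0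
    obtain D where D: "\<And>x. x \<le> 1 \<Longrightarrow> \<bar>flat_exp (flat_exp_deriv 1) x\<bar> \<le> D"
      using flat_exp_bounded by blast
    have "D \<ge> 0" using D[of 0] by linarith
    show ?thesis
    proof (rule uniform_limit_sequentiallyI)
      fix n x assume x: "x \<in> {0..R}"
      have "norm (flat_exp 1 (1 - x / Suc n) - flat_exp 1 1) \<le> D * norm (1 - x / Suc n - 1)"
        by (rule field_differentiable_bound[of "{..1}"])
          (use x D in \<open>auto intro: has_field_derivative_at_within has_real_derivative_flat_exp\<close>)
      also have "\<dots> \<le> D * (R / Suc n)"
        using x \<open>D \<ge> 0\<close> by (intro mult_left_mono) (auto intro: divide_right_mono)
      finally have "exp 1 * \<bar>flat_exp 1 (1 - x / Suc n) - flat_exp 1 1\<bar> \<le> exp 1 * (D * (R / Suc n))"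
        by (intro mult_left_mono) auto
      moreover have "cutoff n x - 1 = of_real (exp 1 * (flat_exp 1 (1 - x / Suc n) - flat_exp 1 1))"
        by (simp add: cutoff_def flat_exp_def algebra_simps exp_minus flip: of_real_mult)
      then have "norm (cutoff n x - 1) = exp 1 * \<bar>flat_exp 1 (1 - x / Suc n) - flat_exp 1 1\<bar>"
        by (simp only: norm_of_real abs_mult) simp
      ultimately show "norm (nderiv k (cutoff n) x - nderiv k (\<lambda>_. 1) x) \<le> exp 1 * D * R / Suc n"
        using 0 by (simp add: mult.assoc)
    qed
  qed
qed

text \<open>Uniqueness of the transform rests on the existence of an approximate unit; otherwise
  every number would satisfy \<open>has_laplace\<close> vacuously.\<close>

lemma laplace_eqI: "has_laplace T s L \<Longrightarrow> laplace T s = L"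
  unfolding laplace_def
  by (rule the_equality) (auto simp: has_laplace_def dest!: spec[of _ cutoff] intro: LIMSEQ_unique approx_unit_cutoff)

lemma has_laplace_laplace: "laplace_exists T s \<Longrightarrow> has_laplace T s (laplace T s)"
  unfolding laplace_exists_def using laplace_eqI by blast

section \<open>Uniqueness of the Laplace transform\<close>

lemma gf_add:
  "generalized_function T \<Longrightarrow> test_fun \<phi> \<Longrightarrow> test_fun \<psi> \<Longrightarrow> T (\<lambda>x. \<phi> x + \<psi> x) = T \<phi> + T \<psi>"
  by (simp add: generalized_function_def)

lemma gf_cmult: "generalized_function T \<Longrightarrow> test_fun \<phi> \<Longrightarrow> T (\<lambda>x. c * \<phi> x) = c * T \<phi>"
  by (simp add: generalized_function_def)

lemma gf_continuous:
  "generalized_function T \<Longrightarrow> (\<And>n. test_fun (\<phi>s n)) \<Longrightarrow> test_fun \<phi> \<Longrightarrow> test_converges \<phi>s \<phi> \<Longrightarrow>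
    (\<lambda>n. T (\<phi>s n)) \<longlonglongrightarrow> T \<phi>"
  by (simp add: generalized_function_def)

lemma gf_zero: "generalized_function T \<Longrightarrow> T (\<lambda>_. 0) = 0"
  using gf_cmult[of T "\<lambda>_. 0" 0] test_funI[OF smooth_halfline_const[of 0]] by simp

lemma gf_sum:
  assumes "generalized_function T" "finite A" "\<And>i. i \<in> A \<Longrightarrow> test_fun (f i)"
  shows "T (\<lambda>x. \<Sum>i\<in>A. c i * f i x) = (\<Sum>i\<in>A. c i * T (f i))"
  using assms(2,3)
proof (induction A rule: finite_induct)
  case empty
  then show ?case by (simp add: gf_zero assms(1))
next
  case (insert a A)
  have "T (\<lambda>x. c a * f a x + (\<Sum>i\<in>A. c i * f i x)) = T (\<lambda>x. c a * f a x) + T (\<lambda>x. \<Sum>i\<in>A. c i * f i x)"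
    using insert by (intro gf_add assms(1) test_fun_cmult test_fun_sum) auto
  then show ?case using insert by (simp add: gf_cmult assms(1))
qed

lemma gf_diff:
  assumes "generalized_function S" "generalized_function T"
  shows "generalized_function (\<lambda>\<phi>. S \<phi> - T \<phi>)"
  unfolding generalized_function_def
proof (intro conjI allI impI)
  fix \<phi>s \<phi> assume "\<forall>n. test_fun (\<phi>s n)" "test_fun \<phi>" "test_converges \<phi>s \<phi>"
  then show "(\<lambda>n. S (\<phi>s n) - T (\<phi>s n)) \<longlonglongrightarrow> S \<phi> - T \<phi>"
    by (intro tendsto_diff gf_continuous assms) auto
qed (simp_all add: gf_add gf_cmult assms algebra_simps)

text \<open>
  If there were no such bound, test functions \<open>\<theta> n\<close> with \<open>T (\<theta> n) = 1\<close> would tend to \<open>0\<close> with all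
  derivatives, and adding them to an approximate unit would give an approximate unit with a
  different limit.
\<close>

lemma integrable_gf_bound:
  assumes T: "generalized_function T" and "laplace_exists T 0"
  shows "\<exists>k C. \<forall>\<phi> B. test_fun \<phi> \<longrightarrow> ck_bound k B \<phi> \<longrightarrow> norm (T \<phi>) \<le> C * B"
proof (rule ccontr)
  assume "\<not> ?thesis"
  \<comment> \<open>The negated bound is used with order n and constant n + 1 at once, giving one
    counterexample for each n.\<close>
  then have "\<exists>\<phi> (B :: real). test_fun \<phi> \<and> ck_bound n B \<phi> \<and> norm (T \<phi>) > Suc n * B" for n
    by (metis not_le)
  then obtain \<phi> and B :: "nat \<Rightarrow> real" where
    \<phi>: "\<And>n. test_fun (\<phi> n)" "\<And>n. ck_bound n (B n) (\<phi> n)" "\<And>n. norm (T (\<phi> n)) > Suc n * B n"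
    by metis
  define \<theta> where "\<theta> n x = inverse (T (\<phi> n)) * \<phi> n x" for n x
  have test: "test_fun (\<theta> n)" for n
    unfolding \<theta>_def by (intro test_fun_cmult \<phi>)
  have pos: "norm (T (\<phi> n)) > 0" for n
    using \<phi>(3)[of n] ck_bound_nonneg[OF \<phi>(2)[of n]]
    by (meson le_less_trans mult_nonneg_nonneg of_nat_0_le_iff)
  have T1: "T (\<theta> n) = 1" for n
    unfolding \<theta>_def using gf_cmult[OF T \<phi>(1)] pos[of n] by simp
  \<comment> \<open>This controls derivatives up to order n only; for a fixed order k it covers all
    but finitely many n.\<close>
  have small: "norm (nderiv k (\<theta> n) x) \<le> 1 / Suc n" if "k \<le> n" "x \<ge> 0" for k n x
  proof -
    have "norm (nderiv k (\<theta> n) x) \<le> norm (inverse (T (\<phi> n))) * B n"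
      unfolding \<theta>_def
      by (rule ck_boundD[OF ck_bound_cmult[OF test_funD[OF \<phi>(1)] \<phi>(2)] that])
    also have "\<dots> = B n / norm (T (\<phi> n))"
      by (simp only: norm_inverse divide_inverse mult.commute)
    also have "\<dots> \<le> 1 / Suc n"
      using \<phi>(3)[of n] pos[of n] by (simp add: field_simps)
    finally show ?thesis .
  qed
  have "approx_unit (\<lambda>n x. cutoff n x + \<theta> n x)"
    unfolding approx_unit_def
  proof (intro conjI allI)
    show "test_fun (\<lambda>x. cutoff n x + \<theta> n x)" for n
      by (intro test_fun_add test_fun_cutoff test)
  next
    fix k
    have nd: "nderiv k (\<lambda>x. cutoff n x + \<theta> n x) x = nderiv k (cutoff n) x + nderiv k (\<theta> n) x"
      if "x \<ge> 0" for n x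
      by (rule nderiv_add[OF smooth_halfline_cutoff test_funD[OF test] that])
    obtain C where C: "\<forall>n. \<forall>x\<ge>0. norm (nderiv k (cutoff n) x) \<le> C"
      using approx_unit_cutoff unfolding approx_unit_def by blast
    obtain D where D: "\<forall>n. \<forall>x\<ge>0. norm (nderiv k (\<theta> n) x) \<le> D n"
      using nderiv_test_fun_bounded[OF test] by metis
    have D0: "D n \<ge> 0" for n using D[rule_format, of 0 n] norm_ge_zero order_trans by blast
    \<comment> \<open>The indices n < k escape \<open>small\<close>, but each is a single test
      function with its own bound \<open>D n\<close>; the sum dominates these finitely many
      bounds.\<close>
    have "norm (nderiv k (\<theta> n) x) \<le> (\<Sum>i<k. D i) + 1" if "x \<ge> 0" for n x
    proof (cases "n < k")
      case True
      have "D n \<le> (\<Sum>i<k. D i)" using True D0 by (intro member_le_sum) auto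
      moreover have "norm (nderiv k (\<theta> n) x) \<le> D n" using D that by blast
      ultimately show ?thesis by linarith
    next
      case False
      have "1 / Suc n \<le> 1" by simp
      moreover have "(\<Sum>i<k. D i) \<ge> 0" by (intro sum_nonneg D0)
      ultimately show ?thesis using small[of k n x] False that by linarith
    qed
    then have "\<forall>n. \<forall>x\<ge>0. norm (nderiv k (\<lambda>x. cutoff n x + \<theta> n x) x) \<le> C + ((\<Sum>i<k. D i) + 1)"
      using C by (auto simp: nd intro!: norm_triangle_le add_mono)
    then show "\<exists>C. \<forall>n. \<forall>x\<ge>0. norm (nderiv k (\<lambda>x. cutoff n x + \<theta> n x) x) \<le> C" by blast
    fix R
    have "uniform_limit {0..R} (\<lambda>n. nderiv k (\<theta> n)) (\<lambda>_. 0) sequentially"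
    proof (rule uniform_limitI)
      fix e :: real assume "e > 0"
      have "\<forall>\<^sub>F n in sequentially. inverse (Suc n) < e"
        by (rule order_tendstoD(2)[OF LIMSEQ_inverse_real_of_nat \<open>e > 0\<close>])
      moreover have "\<forall>\<^sub>F n in sequentially. k \<le> n" by (rule eventually_ge_at_top)
      ultimately show "\<forall>\<^sub>F n in sequentially. \<forall>x\<in>{0..R}. dist (nderiv k (\<theta> n) x) 0 < e"
        by eventually_elim (use small in \<open>force simp: divide_inverse intro: le_less_trans\<close>)
    qed
    moreover have "uniform_limit {0..R} (\<lambda>n. nderiv k (cutoff n)) (nderiv k (\<lambda>_. 1)) sequentially"
      using approx_unit_cutoff unfolding approx_unit_def by blast
    ultimately have "uniform_limit {0..R} (\<lambda>n x. nderiv k (cutoff n) x + nderiv k (\<theta> n) x)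
        (\<lambda>x. nderiv k (\<lambda>_. 1) x + 0) sequentially"
      by (intro uniform_limit_add)
    then show "uniform_limit {0..R} (\<lambda>n. nderiv k (\<lambda>x. cutoff n x + \<theta> n x)) (nderiv k (\<lambda>_. 1)) sequentially"
      by (rule uniform_limit_cong'[THEN iffD1, rotated 2]) (auto simp: nd)
  qed
  moreover obtain L where L: "has_laplace T 0 L"
    using assms(2) by (auto simp: laplace_exists_def)
  ultimately have "(\<lambda>n. T (\<lambda>x. cutoff n x + \<theta> n x)) \<longlonglongrightarrow> L"
    unfolding has_laplace_def by fastforce
  moreover have "(\<lambda>n. T (cutoff n)) \<longlonglongrightarrow> L"
    using L approx_unit_cutoff unfolding has_laplace_def by fastforce
  ultimately have "(\<lambda>n. T (\<lambda>x. cutoff n x + \<theta> n x) - T (cutoff n)) \<longlonglongrightarrow> L - L"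
    by (rule tendsto_diff)
  then have "(\<lambda>n. 1 :: complex) \<longlonglongrightarrow> 0"
    by (simp add: gf_add[OF T test_fun_cutoff test] T1)
  then show False by (simp add: LIMSEQ_const_iff)
qed

section \<open>Density of the polynomials in e^(-x) among test functions\<close>

definition exp_poly :: "complex poly \<Rightarrow> real \<Rightarrow> complex" where
  "exp_poly q x = poly q (of_real (exp (- x)))"

lemma exp_poly_altdef:
  "exp_poly q x = (\<Sum>i\<le>degree q. coeff q i * exp (- of_nat i * of_real x))"
  by (simp add: exp_poly_def poly_altdef exp_of_real[symmetric] exp_of_nat_mult[symmetric])

lemma smooth_halfline_exp_poly: "smooth_halfline (exp_poly q)"
  unfolding exp_poly_altdef[abs_def]
  by (intro smooth_halfline_sum smooth_halfline_cmult smooth_halfline_exp) auto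

lemma has_vector_derivative_exp_poly:
  "(exp_poly q has_vector_derivative - (exp (- of_real x) * exp_poly (pderiv q) x)) (at x within A)"
proof -
  have "((\<lambda>z. poly q (exp (- z))) has_field_derivative poly (pderiv q) (exp (- of_real x)) * (- exp (- of_real x)))
     (at (of_real x))"
    by (rule DERIV_chain2[OF poly_DERIV]) (auto intro!: derivative_eq_intros)
  from has_vector_derivative_real_field[OF this]
  show ?thesis
    by (simp add: exp_poly_def[abs_def] exp_of_real[symmetric] mult.commute has_vector_derivative_at_within)
qed

lemma exp_poly_tendsto: "(exp_poly q \<longlongrightarrow> poly q 0) at_top"
proof -
  have "((\<lambda>x::real. exp (- x)) \<longlongrightarrow> 0) at_top"
    by (rule filterlim_compose[OF exp_at_bot filterlim_uminus_at_bot_at_top])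
  then have "((\<lambda>x. poly q (of_real (exp (- x)))) \<longlongrightarrow> poly q (of_real 0)) at_top"
    by (intro tendsto_intros)
  then show ?thesis by (simp add: exp_poly_def[abs_def])
qed

text \<open>The normalisation at 0 makes \<open>exp_poly Q x\<close> tend to 0 as x tends to
  infinity; it fixes the constant of integration in \<open>exp_poly_dense\<close>.\<close>

lemma poly_antiderivative:
  fixes q :: "'a :: field_char_0 poly"
  shows "\<exists>Q. pderiv Q = q \<and> poly Q 0 = 0"
proof (intro exI conjI)
  let ?Q = "\<Sum>i\<le>degree q. monom (coeff q i / of_nat (Suc i)) (Suc i)"
  have "pderiv (\<Sum>i\<in>I. f i) = (\<Sum>i\<in>I. pderiv (f i))" for I :: "nat set" and f :: "nat \<Rightarrow> 'a poly"
    by (induction I rule: infinite_finite_induct) (auto simp: pderiv_add)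
  then show "pderiv ?Q = q"
    by (simp add: pderiv_monom poly_as_sum_of_monoms del: of_nat_Suc)
  show "poly ?Q 0 = 0"
    by (simp add: poly_sum poly_monom)
qed

text \<open>The function y \<mapsto> \<phi>(-ln y) extends continuously by 0 to y = 0 because \<phi>
  has bounded support. Real and imaginary parts are approximated separately, each within
  e/2.\<close>

lemma exp_poly_dense_uniform:
  assumes "test_fun \<phi>" "e > 0"
  shows "\<exists>q. \<forall>x\<ge>0. norm (\<phi> x - exp_poly q x) \<le> e"
proof -
  obtain R where R: "R \<ge> 0" "\<forall>x>R. \<phi> x = 0" using test_fun_support[OF assms(1)] by blast
  \<comment> \<open>At y = m the logarithm gives x = R + 1, beyond the support, so the two branches
    of \<open>g\<close> match there.\<close>
  define m where "m = exp (- (R + 1))"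
  have m: "0 < m" "m \<le> 1" using R by (auto simp: m_def)
  define g where "g y = (if y \<le> m then 0 else \<phi> (- ln y))" for y
  have "continuous_on {m..1} (\<lambda>y. \<phi> (- ln y))"
  proof (rule continuous_on_compose2[OF continuous_on_smooth_halfline[OF test_funD[OF assms(1)]]])
    show "continuous_on {m..1} (\<lambda>y. - ln y)"
      using m by (intro continuous_intros) auto
  qed (use m in auto)
  moreover have "\<phi> (- ln m) = 0" using R by (simp add: m_def)
  ultimately have "continuous_on ({0..m} \<union> {m..1}) g"
    unfolding g_def
    by (intro continuous_on_If) (auto simp: order_antisym_conv)
  moreover have "{0..m} \<union> {m..1} = {0..1}" using m by auto
  ultimately have cont: "continuous_on {0..1} g" by simp
  obtain u where u: "real_polynomial_function u" "\<And>x. x \<in> {0..1} \<Longrightarrow> \<bar>Re (g x) - u x\<bar> < e / 2"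
    by (rule Stone_Weierstrass_real_polynomial_function[of "{0..1}" "\<lambda>x. Re (g x)" "e / 2"])
      (use cont assms in \<open>auto intro: continuous_on_Re\<close>)
  obtain v where v: "real_polynomial_function v" "\<And>x. x \<in> {0..1} \<Longrightarrow> \<bar>Im (g x) - v x\<bar> < e / 2"
    by (rule Stone_Weierstrass_real_polynomial_function[of "{0..1}" "\<lambda>x. Im (g x)" "e / 2"])
      (use cont assms in \<open>auto intro: continuous_on_Im\<close>)
  obtain a n where a: "u = (\<lambda>x. \<Sum>i\<le>n. a i * x ^ i)"
    using real_polynomial_function_imp_sum[OF u(1)] by blast
  obtain b n' where b: "v = (\<lambda>x. \<Sum>i\<le>n'. b i * x ^ i)"
    using real_polynomial_function_imp_sum[OF v(1)] by blast
  define q where "q = (\<Sum>i\<le>n. monom (complex_of_real (a i)) i) + (\<Sum>i\<le>n'. monom (\<i> * complex_of_real (b i)) i)"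
  have q: "poly q (of_real y) = of_real (u y) + \<i> * of_real (v y)" for y
    by (simp add: q_def a b poly_sum poly_monom sum_distrib_left mult.assoc)
  have "norm (\<phi> x - exp_poly q x) \<le> e" if "x \<ge> 0" for x
  proof -
    let ?y = "exp (- x)"
    have y: "?y \<in> {0..1}" using that by auto
    have "\<phi> x = g ?y"
      using R by (auto simp: g_def m_def)
    then have "norm (\<phi> x - exp_poly q x) \<le> \<bar>Re (g ?y - poly q (of_real ?y))\<bar> + \<bar>Im (g ?y - poly q (of_real ?y))\<bar>"
      unfolding exp_poly_def by (simp only: cmod_le)
    also have "\<dots> \<le> e"
      using u(2)[OF y] v(2)[OF y] by (simp add: q)
    finally show ?thesis .
  qed
  then show ?thesis by blast
qed

text \<open>Approximate the derivative and integrate. Since \<open>exp_poly Q\<close> has derivative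
  -e^(-x) Q'(e^(-x)), a C^k approximation q of e^x \<phi>'(x) with Q' = -q leaves the error r with
  r' = e^(-x) (e^x \<phi>'(x) - q(e^(-x))). The decay of the factor e^(-x) then bounds r itself by
  integrating from infinity.\<close>

lemma exp_poly_dense:
  assumes "test_fun \<phi>" "e > 0"
  shows "\<exists>q. ck_bound k e (\<lambda>x. \<phi> x - exp_poly q x)"
  using assms
proof (induction k arbitrary: \<phi> e)
  case 0
  then show ?case using exp_poly_dense_uniform[of \<phi> e] by (auto simp: ck_bound_def)
next
  case (Suc k)
  let ?E = "\<lambda>x. exp (- 1 * of_real x) :: complex"
  \<comment> \<open>Compensates the factor 2^k lost in \<open>ck_bound_mult\<close>.\<close>
  define d where "d = e / 2 ^ k"
  have d: "d > 0" "d \<le> e" using Suc.prems by (auto simp: d_def field_simps)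
  have "test_fun (\<lambda>x. nderiv 1 \<phi> x * exp (1 * of_real x))"
    by (intro test_fun_mult test_fun_nderiv1 Suc.prems smooth_halfline_exp)
  from Suc.IH[OF this d(1)] obtain q where
    q: "ck_bound k d (\<lambda>x. nderiv 1 \<phi> x * exp (1 * of_real x) - exp_poly q x)" ..
  obtain Q where Q: "pderiv Q = - q" "poly Q 0 = 0" using poly_antiderivative by blast
  define r where "r x = \<phi> x - exp_poly Q x" for x
  define f where "f x = ?E x * (nderiv 1 \<phi> x * exp (1 * of_real x) - exp_poly q x)" for x
  have smooth_r: "smooth_halfline r"
    unfolding r_def by (intro smooth_halfline_diff test_funD Suc.prems smooth_halfline_exp_poly)
  have r': "nderiv 1 r x = f x" if "x \<ge> 0" for x
  proof -
    have "(exp_poly Q has_vector_derivative - (exp (- of_real x) * exp_poly (- q) x)) (at x within {0..})"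
      using has_vector_derivative_exp_poly[of Q x "{0..}"] Q by simp
    from has_vector_derivative_diff[OF has_vector_derivative_nderiv[OF test_funD[OF Suc.prems(1)] that, of 0] this]
    have "(r has_vector_derivative f x) (at x within {0..})"
      by (simp add: r_def[abs_def] f_def exp_poly_def exp_minus field_simps)
    then show ?thesis
      using vector_derivative_within[OF at_within_halfline_neq_bot[OF that]] nderiv_Suc[of 0 r x] by simp
  qed
  have smooth_f: "smooth_halfline (\<lambda>x. nderiv 1 \<phi> x * exp (1 * of_real x) - exp_poly q x)"
    by (intro smooth_halfline_diff smooth_halfline_mult smooth_halfline_nderiv1 test_funD Suc.prems
        smooth_halfline_exp smooth_halfline_exp_poly)
  have "ck_bound k 1 ?E"
    using nderiv_exp[of _ _ "- 1"] by (auto simp: ck_bound_def norm_mult norm_power)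
  from ck_bound_mult[OF smooth_halfline_exp smooth_f this q]
  moreover have "2 ^ k * 1 * d = e" by (simp add: d_def)
  ultimately have f: "ck_bound k e f" unfolding f_def[abs_def] by (simp only:)
  have "norm (nderiv j r x) \<le> e" if "j \<le> Suc k" "x \<ge> 0" for j x
  proof (cases j)
    case (Suc i)
    have "smooth_halfline f"
      unfolding f_def[abs_def] by (rule smooth_halfline_mult[OF smooth_halfline_exp smooth_f])
    then have "nderiv i (nderiv 1 r) x = nderiv i f x"
      by (intro nderiv_eqI[where F="\<lambda>k. nderiv k f"] has_vector_derivative_nderiv)
        (use r' that in auto)
    moreover have "nderiv j r = nderiv i (nderiv 1 r)"
      unfolding Suc by (rule nderiv_Suc_shift)
    ultimately show ?thesis
      using ck_boundD[OF f, of i x] that Suc by simp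
  next
    case 0
    obtain R where R: "R \<ge> 0" "\<forall>x>R. \<phi> x = 0" using test_fun_support[OF Suc.prems(1)] by blast
    \<comment> \<open>The integral of d e^(-z) over [x,y] stays below d for every y, so letting y
      tend to infinity, where r tends to 0, bounds r at x.\<close>
    have "norm (r x) \<le> d + norm (r y)" if y: "y > x" for y
    proof -
      have "norm (r y - r x) \<le> - d * exp (- y) - (- d * exp (- x))"
      proof (rule differentiable_bound_general[where f' = f and \<phi>' = "\<lambda>z. d * exp (- z)"])
        show "continuous_on {x..y} r"
          by (rule continuous_on_subset[OF continuous_on_smooth_halfline[OF smooth_r]]) (use \<open>x \<ge> 0\<close> in auto)
        show "continuous_on {x..y} (\<lambda>x. - d * exp (- x))" by (intro continuous_intros)
      next
        fix z assume z: "x < z" "z < y"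
        have "at z within {0..} = at z" using z \<open>x \<ge> 0\<close> by (intro at_within_interior) auto
        then show "(r has_vector_derivative f z) (at z)"
          using has_vector_derivative_nderiv[OF smooth_r, of z 0] r'[of z] z \<open>x \<ge> 0\<close> by simp
        show "((\<lambda>x. - d * exp (- x)) has_vector_derivative d * exp (- z)) (at z)"
          unfolding has_real_derivative_iff_has_vector_derivative[symmetric]
          by (auto intro!: derivative_eq_intros)
        show "norm (f z) \<le> d * exp (- z)"
          using ck_boundD[OF q, of 0 z] z \<open>x \<ge> 0\<close> by (simp add: f_def norm_mult)
      qed (rule y)
      also have "\<dots> \<le> d * exp (- x)" using d by simp
      also have "\<dots> \<le> d * 1" using d \<open>x \<ge> 0\<close> by (intro mult_left_mono) auto
      finally have "norm (r y - r x) \<le> d" by simp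
      then show ?thesis using norm_triangle_ineq4[of "r y" "r y - r x"] by simp
    qed
    then have ev: "\<forall>\<^sub>F y in at_top. norm (r x) \<le> d + norm (r y)"
      by (rule eventually_mono[OF eventually_gt_at_top[of x]])
    have "(r \<longlongrightarrow> 0) at_top"
    proof (rule Lim_transform_eventually)
      show "((\<lambda>x. - exp_poly Q x) \<longlongrightarrow> 0) at_top"
        using tendsto_minus[OF exp_poly_tendsto[of Q]] Q by simp
      show "\<forall>\<^sub>F x in at_top. - exp_poly Q x = r x"
        using eventually_gt_at_top[of R] by eventually_elim (use R in \<open>simp add: r_def\<close>)
    qed
    then have "((\<lambda>y. d + norm (r y)) \<longlongrightarrow> d + 0) at_top"
      by (intro tendsto_add tendsto_const tendsto_norm_zero)
    from tendsto_lowerbound[OF this ev]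
    show ?thesis using 0 d by simp
  qed
  then show ?case unfolding r_def ck_bound_def by blast
qed

section \<open>Injectivity of the transform\<close>

text \<open>Insert a cutoff and split \<phi> into \<open>exp_poly q\<close> and an error of C^k size
  e. The polynomial part tends to a combination of transforms at integers, all 0. The error part is
  at most a constant times e, uniformly in n, because the cutoffs share the C^k bound
  \<open>A\<close>.\<close>

lemma laplace_zero_imp_zero:
  assumes T: "generalized_function T" and L: "\<And>n :: nat. has_laplace T (of_nat n) 0"
    and \<phi>: "test_fun \<phi>"
  shows "T \<phi> = 0"
proof -
  have "laplace_exists T 0" using L[of 0] by (auto simp: laplace_exists_def)
  then obtain k C where C: "\<And>\<phi> B. test_fun \<phi> \<Longrightarrow> ck_bound k B \<phi> \<Longrightarrow> norm (T \<phi>) \<le> C * B"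
    using integrable_gf_bound[OF T] by blast
  have "\<exists>D. \<forall>n. \<forall>x\<ge>0. norm (nderiv j (cutoff n) x) \<le> D" for j
    using approx_unit_cutoff unfolding approx_unit_def by blast
  then obtain D where D: "\<And>j n x. x \<ge> 0 \<Longrightarrow> norm (nderiv j (cutoff n) x) \<le> D j" by metis
  define A where "A = (\<Sum>j\<le>k. D j)"
  have D0: "D j \<ge> 0" for j using D[of 0 j 0] norm_ge_zero order_trans by blast
  have A: "ck_bound k A (cutoff n)" for n
    unfolding ck_bound_def A_def
    using D D0 member_le_sum[of _ "{..k}" D] by (metis atMost_iff finite_atMost order_trans)
  have conv: "(\<lambda>n. T (\<lambda>x. cutoff n x * \<phi> x)) \<longlonglongrightarrow> T \<phi>"
  proof -
    obtain R where R: "R \<ge> 0" "\<forall>x>R. \<phi> x = 0" using test_fun_support[OF \<phi>] by blast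
    have "test_converges (\<lambda>n x. cutoff n x * \<phi> x) \<phi>"
      unfolding test_converges_def
    proof (intro conjI allI)
      show "\<exists>R. \<forall>n. \<forall>x>R. cutoff n x * \<phi> x = 0" using R by auto
    next
      fix j
      have "uniform_limit {0..R} (\<lambda>n. nderiv j (\<lambda>x. cutoff n x * \<phi> x)) (nderiv j (\<lambda>x. 1 * \<phi> x)) sequentially"
        by (rule uniform_limit_nderiv_mult[OF smooth_halfline_cutoff smooth_halfline_const test_funD[OF \<phi>]])
          (use approx_unit_cutoff in \<open>auto simp: approx_unit_def\<close>)
      then have "uniform_limit {0..R} (\<lambda>n. nderiv j (\<lambda>x. cutoff n x * \<phi> x)) (nderiv j \<phi>) sequentially"
        by simp
      \<comment> \<open>Beyond R all functions involved vanish, so convergence on the whole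
        half-line reduces to a compact interval.\<close>
      moreover have "uniform_limit {R<..} (\<lambda>n. nderiv j (\<lambda>x. cutoff n x * \<phi> x)) (nderiv j \<phi>) sequentially"
      proof (rule uniform_limitI)
        fix e :: real assume "e > 0"
        have "dist (nderiv j (\<lambda>x. cutoff n x * \<phi> x) x) (nderiv j \<phi> x) < e" if "x > R" for n x
        proof -
          have "nderiv j \<phi> x = 0"
            by (rule nderiv_eq_0_beyond[of R]) (use R that in auto)
          moreover have "nderiv j (\<lambda>x. cutoff n x * \<phi> x) x = 0"
            by (rule nderiv_eq_0_beyond[of R]) (use R that in auto)
          ultimately show ?thesis using \<open>e > 0\<close> by simp
        qed
        then show "\<forall>\<^sub>F n in sequentially. \<forall>x\<in>{R<..}.
            dist (nderiv j (\<lambda>x. cutoff n x * \<phi> x) x) (nderiv j \<phi> x) < e"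
          by (intro always_eventually) auto
      qed
      ultimately have "uniform_limit ({0..R} \<union> {R<..}) (\<lambda>n. nderiv j (\<lambda>x. cutoff n x * \<phi> x)) (nderiv j \<phi>) sequentially"
        by (rule uniform_limit_on_Un)
      moreover have "{0..R} \<union> {R<..} = {0..}" using R by auto
      ultimately show "uniform_limit {0..} (\<lambda>n. nderiv j (\<lambda>x. cutoff n x * \<phi> x)) (nderiv j \<phi>) sequentially"
        by simp
    qed
    then show ?thesis
      by (rule gf_continuous[OF T test_fun_mult[OF test_fun_cutoff test_funD[OF \<phi>]] \<phi>])
  qed
  have bound: "norm (T \<phi>) \<le> C * (2 ^ k * A * e)" if "e > 0" for e
  proof -
    obtain q where q: "ck_bound k e (\<lambda>x. \<phi> x - exp_poly q x)"
      using exp_poly_dense[OF \<phi> \<open>e > 0\<close>] by blast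
    have smooth: "smooth_halfline (\<lambda>x. \<phi> x - exp_poly q x)"
      by (intro smooth_halfline_diff test_funD \<phi> smooth_halfline_exp_poly)
    have test: "test_fun (\<lambda>x. cutoff n x * (\<phi> x - exp_poly q x))"
        "test_fun (\<lambda>x. cutoff n x * exp_poly q x)" for n
      by (rule test_fun_mult[OF test_fun_cutoff smooth] test_fun_mult[OF test_fun_cutoff smooth_halfline_exp_poly])+
    have "T (\<lambda>x. cutoff n x * exp_poly q x) =
        (\<Sum>i\<le>degree q. coeff q i * T (\<lambda>x. cutoff n x * exp (- of_nat i * of_real x)))" for n
    proof -
      have "T (\<lambda>x. \<Sum>i\<le>degree q. coeff q i * (cutoff n x * exp (- of_nat i * of_real x))) =
        (\<Sum>i\<le>degree q. coeff q i * T (\<lambda>x. cutoff n x * exp (- of_nat i * of_real x)))"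
        by (intro gf_sum[OF T] test_fun_mult[OF test_fun_cutoff smooth_halfline_exp]) auto
      then show ?thesis by (simp add: exp_poly_altdef sum_distrib_left mult_ac)
    qed
    moreover have "(\<lambda>n. \<Sum>i\<le>degree q. coeff q i * T (\<lambda>x. cutoff n x * exp (- of_nat i * of_real x)))
        \<longlonglongrightarrow> (\<Sum>i\<le>degree q. coeff q i * 0)"
      using L approx_unit_cutoff unfolding has_laplace_def
      by (intro tendsto_sum tendsto_mult_left) blast
    ultimately have "(\<lambda>n. T (\<lambda>x. cutoff n x * exp_poly q x)) \<longlonglongrightarrow> 0" by simp
    from tendsto_diff[OF conv this]
    have "(\<lambda>n. T (\<lambda>x. cutoff n x * \<phi> x) - T (\<lambda>x. cutoff n x * exp_poly q x)) \<longlonglongrightarrow> T \<phi>" by simp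
    moreover have "T (\<lambda>x. cutoff n x * \<phi> x) =
        T (\<lambda>x. cutoff n x * (\<phi> x - exp_poly q x)) + T (\<lambda>x. cutoff n x * exp_poly q x)" for n
      using gf_add[OF T test(1)[of n] test(2)[of n]] by (simp add: algebra_simps)
    ultimately have "(\<lambda>n. T (\<lambda>x. cutoff n x * (\<phi> x - exp_poly q x))) \<longlonglongrightarrow> T \<phi>" by simp
    moreover have "norm (T (\<lambda>x. cutoff n x * (\<phi> x - exp_poly q x))) \<le> C * (2 ^ k * A * e)" for n
      by (intro C test ck_bound_mult smooth_halfline_cutoff smooth A q)
    ultimately show ?thesis
      by (intro Lim_norm_ubound[OF sequentially_bot]) auto
  qed
  have "((\<lambda>e. C * (2 ^ k * A * e)) \<longlongrightarrow> C * (2 ^ k * A * 0)) (at_right 0)"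
    by (intro tendsto_intros)
  moreover have "\<forall>\<^sub>F e in at_right 0. norm (T \<phi>) \<le> C * (2 ^ k * A * e)"
    using bound by (auto simp: eventually_at_right_less intro: eventually_at_rightI[of 0 1])
  ultimately have "norm (T \<phi>) \<le> C * (2 ^ k * A * 0)"
    by (rule tendsto_lowerbound) simp
  then show ?thesis by simp
qed

text \<open>The hypothesis asks for a common witness: an equation between the two descriptions
  \<open>laplace S s\<close> and \<open>laplace T s\<close> would carry no information where a
  transform fails to exist.\<close>

lemma laplace_unique:
  assumes S: "generalized_function S" and T: "generalized_function T"
    and "\<And>s. Re s \<ge> 0 \<Longrightarrow> \<exists>L. has_laplace S s L \<and> has_laplace T s L"
  shows "gf_eq S T"
  unfolding gf_eq_def
proof (intro allI impI)
  fix \<phi> assume "test_fun \<phi>"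
  have "has_laplace (\<lambda>\<phi>. S \<phi> - T \<phi>) (of_nat n) 0" for n :: nat
  proof -
    obtain L where "has_laplace S (of_nat n) L" "has_laplace T (of_nat n) L"
      using assms(3)[of "of_nat n"] by auto
    then show ?thesis
      unfolding has_laplace_def using tendsto_diff[of _ L _ _ L] by fastforce
  qed
  from laplace_zero_imp_zero[OF gf_diff[OF S T] this \<open>test_fun \<phi>\<close>]
  show "S \<phi> = T \<phi>" by simp
qed

section \<open>Compactly supported functionals\<close>

text \<open>
  These extend to all smooth functions on the half-line, so that the Laplace transform is the
  value at the exponential.
\<close>

definition continuous_up_to :: "real \<Rightarrow> functional \<Rightarrow> bool" where
  "continuous_up_to R T \<longleftrightarrow>
     (\<forall>f g. smooth_halfline f \<longrightarrow> smooth_halfline g \<longrightarrow> T (\<lambda>x. f x + g x) = T f + T g) \<and>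
     (\<forall>c f. smooth_halfline f \<longrightarrow> T (\<lambda>x. c * f x) = c * T f) \<and>
     (\<forall>fs f. (\<forall>n. smooth_halfline (fs n)) \<longrightarrow> smooth_halfline f \<longrightarrow>
        (\<forall>k. uniform_limit {0..R} (\<lambda>n. nderiv k (fs n)) (nderiv k f) sequentially) \<longrightarrow>
        (\<lambda>n. T (fs n)) \<longlonglongrightarrow> T f)"

lemma generalized_function_continuous_up_to:
  assumes "continuous_up_to R T" shows "generalized_function T"
  unfolding generalized_function_def
proof (intro conjI allI impI)
  fix \<phi>s \<phi> assume *: "\<forall>n. test_fun (\<phi>s n)" "test_fun \<phi>" "test_converges \<phi>s \<phi>"
  have "uniform_limit {0..R} (\<lambda>n. nderiv k (\<phi>s n)) (nderiv k \<phi>) sequentially" for k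
  proof (rule uniform_limit_on_subset)
    show "uniform_limit {0..} (\<lambda>n. nderiv k (\<phi>s n)) (nderiv k \<phi>) sequentially"
      using *(3) by (simp add: test_converges_def)
  qed auto
  then show "(\<lambda>n. T (\<phi>s n)) \<longlonglongrightarrow> T \<phi>"
    using assms * by (simp add: continuous_up_to_def test_funD)
qed (use assms in \<open>simp_all add: continuous_up_to_def test_funD\<close>)

text \<open>On [0,R] an approximate unit times the exponential converges to the exponential with all
  derivatives, and convergence there is all that \<open>T\<close> sees.\<close>

lemma has_laplace_continuous_up_to:
  assumes T: "continuous_up_to R T"
  shows "has_laplace T s (T (\<lambda>x. exp (- s * of_real x)))"
  unfolding has_laplace_def
proof (intro allI impI)
  fix \<psi> assume \<psi>: "approx_unit \<psi>"
  have sm: "smooth_halfline (\<psi> n)" for n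
    using \<psi> by (simp add: approx_unit_def test_funD)
  have "uniform_limit {0..R} (\<lambda>n. nderiv k (\<lambda>x. \<psi> n x * exp (- s * of_real x)))
      (nderiv k (\<lambda>x. 1 * exp (- s * of_real x))) sequentially" for k
    by (rule uniform_limit_nderiv_mult[OF sm smooth_halfline_const smooth_halfline_exp])
      (use \<psi> in \<open>auto simp: approx_unit_def\<close>)
  moreover have "smooth_halfline (\<lambda>x. \<psi> n x * exp (- s * of_real x))" for n
    by (rule smooth_halfline_mult[OF sm smooth_halfline_exp])
  ultimately show "(\<lambda>n. T (\<lambda>x. \<psi> n x * exp (- s * of_real x))) \<longlonglongrightarrow> T (\<lambda>x. exp (- s * of_real x))"
    using T smooth_halfline_exp[of "- s"] by (simp add: continuous_up_to_def)
qed

lemma laplace_continuous_up_to: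
  "continuous_up_to R T \<Longrightarrow> laplace T s = T (\<lambda>x. exp (- s * of_real x))"
  by (intro laplace_eqI has_laplace_continuous_up_to)

lemma continuous_up_to_add:
  assumes "continuous_up_to R S" "continuous_up_to R T"
  shows "continuous_up_to R (\<lambda>f. S f + T f)"
  using assms by (simp add: continuous_up_to_def algebra_simps tendsto_add)

lemma continuous_up_to_cmult:
  assumes "continuous_up_to R T" shows "continuous_up_to R (\<lambda>f. c * T f)"
  using assms by (simp add: continuous_up_to_def algebra_simps tendsto_mult_left)

text \<open>Order 0 is the point mass at t; order 1 arises when the moving mass \<delta>(x - t) is
  differentiated in t.\<close>

lemma continuous_up_to_eval_nderiv:
  assumes "0 \<le> t" shows "continuous_up_to t (\<lambda>f. nderiv k f t)"
  unfolding continuous_up_to_def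
proof (intro conjI allI impI)
  fix fs f assume "\<forall>k. uniform_limit {0..t} (\<lambda>n. nderiv k (fs n)) (nderiv k f) sequentially"
  then show "(\<lambda>n. nderiv k (fs n) t) \<longlonglongrightarrow> nderiv k f t"
    using assms by (intro tendsto_uniform_limitI[where S="{0..t}"]) auto
qed (use assms in \<open>simp_all add: nderiv_add nderiv_cmult\<close>)

lemma continuous_up_to_integral:
  assumes "0 \<le> t" and h: "continuous_on {0..t} h"
  shows "continuous_up_to t (\<lambda>f. integral {0..t} (\<lambda>x. h x * f x))"
proof -
  have cont: "continuous_on {0..t} (\<lambda>x. h x * f x)" if "smooth_halfline f" for f
    by (intro continuous_on_mult h continuous_on_subset[OF continuous_on_smooth_halfline[OF that]]) auto
  note int = integrable_continuous_interval[OF cont]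
  show ?thesis
    unfolding continuous_up_to_def
  proof (intro conjI allI impI)
    fix f g assume "smooth_halfline f" "smooth_halfline g"
    then show "integral {0..t} (\<lambda>x. h x * (f x + g x)) =
        integral {0..t} (\<lambda>x. h x * f x) + integral {0..t} (\<lambda>x. h x * g x)"
      using integral_add[OF int int, of f g] by (simp add: algebra_simps)
  next
    fix c f
    show "integral {0..t} (\<lambda>x. h x * (c * f x)) = c * integral {0..t} (\<lambda>x. h x * f x)"
      by (simp add: mult.left_commute)
  next
    fix fs f
    assume fs: "\<forall>n. smooth_halfline (fs n)" and f: "smooth_halfline f"
      and lim: "\<forall>k. uniform_limit {0..t} (\<lambda>n. nderiv k (fs n)) (nderiv k f) sequentially"
    have "uniform_limit {0..t} (\<lambda>n x. h x * fs n x) (\<lambda>x. h x * f x) sequentially"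
    proof (rule bounded_bilinear.bounded_uniform_limit[OF bounded_bilinear_mult])
      show "uniform_limit {0..t} fs f sequentially" using lim[rule_format, of 0] by simp
      show "bounded (h ` {0..t})"
        by (intro compact_imp_bounded compact_continuous_image h) auto
      show "bounded (f ` {0..t})"
        by (intro compact_imp_bounded compact_continuous_image
            continuous_on_subset[OF continuous_on_smooth_halfline[OF f]]) auto
    qed (rule uniform_limit_const)
    then obtain I J where IJ: "\<And>n. ((\<lambda>x. h x * fs n x) has_integral I n) {0..t}"
        "((\<lambda>x. h x * f x) has_integral J) {0..t}" "I \<longlonglongrightarrow> J"
      by (rule uniform_limit_integral) (use fs cont in auto)
    moreover have "I = (\<lambda>n. integral {0..t} (\<lambda>x. h x * fs n x))"
      by (intro ext) (simp add: integral_unique[OF IJ(1)])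
    ultimately show "(\<lambda>n. integral {0..t} (\<lambda>x. h x * fs n x)) \<longlonglongrightarrow> integral {0..t} (\<lambda>x. h x * f x)"
      by (simp add: integral_unique)
  qed
qed

text \<open>The exponential is itself an admissible \<open>f\<close>, so differentiating the pairing
  at it already differentiates the transform.\<close>

lemma derivative_commutes_with_laplaceI:
  assumes p: "\<And>t. t > 0 \<Longrightarrow> continuous_up_to t (p t)"
    and D: "\<And>t. t > 0 \<Longrightarrow> continuous_up_to t (D t)"
    and deriv: "\<And>t f. t > 0 \<Longrightarrow> smooth_halfline f \<Longrightarrow> ((\<lambda>u. p u f) has_vector_derivative D t f) (at t)"
  shows "derivative_commutes_with_laplace p"
  unfolding derivative_commutes_with_laplace_def
proof (intro allI impI)
  fix t :: real assume "t > 0"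
  have "((\<lambda>u. laplace (p u) s) has_vector_derivative laplace (D t) s) (at t)" for s
    unfolding laplace_continuous_up_to[OF D[OF \<open>t > 0\<close>]]
    by (rule has_vector_derivative_transform_within_open[OF deriv[OF \<open>t > 0\<close> smooth_halfline_exp], of "{0<..}"])
      (use \<open>t > 0\<close> laplace_continuous_up_to[OF p] in auto)
  then show "\<exists>D. generalized_function D \<and>
        (\<forall>\<phi>. test_fun \<phi> \<longrightarrow> ((\<lambda>u. p u \<phi>) has_vector_derivative D \<phi>) (at t)) \<and>
        (\<forall>s. Re s \<ge> 0 \<longrightarrow> laplace_exists D s \<and>
           ((\<lambda>u. laplace (p u) s) has_vector_derivative laplace D s) (at t))"
    using generalized_function_continuous_up_to[OF D[OF \<open>t > 0\<close>]] deriv[OF \<open>t > 0\<close>]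
      has_laplace_continuous_up_to[OF D[OF \<open>t > 0\<close>]]
    by (intro exI[of _ "D t"]) (auto simp: laplace_exists_def test_funD)
qed

lemma integral_has_vector_derivative_halfline:
  fixes f :: "real \<Rightarrow> 'a :: banach"
  assumes "continuous_on {0..} f" "t \<ge> 0"
  shows "((\<lambda>u. integral {0..u} f) has_vector_derivative f t) (at t within {0..})"
proof -
  have "((\<lambda>u. integral {0..u} f) has_vector_derivative f t) (at t within {0..t + 1})"
    by (rule integral_has_vector_derivative)
      (use assms in \<open>auto intro: continuous_on_subset\<close>)
  moreover have "at t within {0..t + 1} = at t within {0..}"
    using \<open>t \<ge> 0\<close> by (intro at_within_nhd[of _ "{..<t + 1}"]) auto
  ultimately show ?thesis by simp
qed

section \<open>Densities carried along the characteristics\<close>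

text \<open>Pairing with the density created by a boundary inflow e^(z u) that moves at unit speed
  and decays at rate b: what sits at x at time t entered at time t - x.\<close>

definition exp_conv :: "real \<Rightarrow> real \<Rightarrow> real \<Rightarrow> functional" where
  "exp_conv b z t f = integral {0..t} (\<lambda>x. of_real (exp (- b * x) * exp (z * (t - x))) * f x)"

lemma continuous_up_to_exp_conv: "0 \<le> t \<Longrightarrow> continuous_up_to t (exp_conv b z t)"
  unfolding exp_conv_def by (intro continuous_up_to_integral continuous_intros)

text \<open>Factoring out e^(z u) leaves an integrand free of the time u, which then occurs only in
  that factor and in the upper limit.\<close>

lemma has_vector_derivative_exp_conv:
  assumes f: "smooth_halfline f" and "t > 0"
  shows "((\<lambda>u. exp_conv b z u f) has_vector_derivative
     of_real z * exp_conv b z t f + of_real (exp (- b * t)) * f t) (at t)"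
proof -
  define J where "J u = integral {0..u} (\<lambda>x. of_real (exp (- (b + z) * x)) * f x)" for u
  have eq: "exp_conv b z u f = of_real (exp (z * u)) * J u" for u
    unfolding exp_conv_def J_def integral_mult_right[symmetric]
    by (intro arg_cong[where f="integral _"] ext)
      (simp add: algebra_simps flip: exp_add of_real_mult)
  have "at t within {0..} = at t" using \<open>t > 0\<close> by (intro at_within_interior) auto
  then have J: "(J has_vector_derivative of_real (exp (- (b + z) * t)) * f t) (at t)"
    using integral_has_vector_derivative_halfline[of "\<lambda>x. of_real (exp (- (b + z) * x)) * f x" t] \<open>t > 0\<close>
    unfolding J_def[abs_def]
    by (simp add: continuous_intros continuous_on_smooth_halfline[OF f])
  have "((\<lambda>u. complex_of_real (exp (z * u))) has_vector_derivative of_real (z * exp (z * t))) (at t)"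
    by (intro has_vector_derivative_of_real)
      (auto intro!: derivative_eq_intros)
  from has_vector_derivative_mult[OF this J] show ?thesis
    unfolding eq by (rule has_vector_derivative_eq_rhs) (simp add: algebra_simps flip: exp_add of_real_mult)
qed

lemma integral_reflect_Icc:
  fixes f :: "real \<Rightarrow> complex"
  assumes "f integrable_on {0..t}"
  shows "integral {0..t} (\<lambda>x. f (t - x)) = integral {0..t} f"
proof -
  have "(f has_integral integral {0..t} f) (cbox 0 t)" using assms by (simp add: integrable_integral)
  from has_integral_affinity[OF this, of "-1" t]
  have "((\<lambda>x. f (t - x)) has_integral integral {0..t} f) ((\<lambda>x. t - x) ` {0..t})"
    by (simp add: algebra_simps)
  then show ?thesis by (simp add: integral_unique image_diff_atLeastAtMost)
qed

text \<open>The substitution of entry time t - x for position x turns the transform into the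
  integral of the variation-of-constants formula.\<close>

lemma exp_conv_exp:
  "exp_conv b z t (\<lambda>x. exp (- s * of_real x)) =
     integral {0..t} (\<lambda>u. exp (- (of_real b + s) * of_real (t - u)) * of_real (exp (z * u)))"
proof -
  have "(\<lambda>u. exp (- (of_real b + s) * of_real (t - u)) * of_real (exp (z * u))) integrable_on {0..t}"
    by (intro integrable_continuous_interval continuous_intros)
  from integral_reflect_Icc[OF this] show ?thesis
    unfolding exp_conv_def
    by (simp add: exp_of_real[symmetric] algebra_simps flip: exp_add)
qed

section \<open>The Volterra system for the total masses\<close>

lemma set_integrable_exp_mult:
  assumes "set_integrable lborel {0..t} f"
  shows "set_integrable lborel {0..t} (\<lambda>u. exp (c * of_real u) * (f u :: complex))"
  unfolding set_integrable_def
proof (rule Bochner_Integration.integrable_bound)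
  let ?g = "\<lambda>u. indicator {0..t} u *\<^sub>R f u"
  have g: "integrable lborel ?g" using assms by (simp add: set_integrable_def)
  show "integrable lborel (\<lambda>u. exp (norm c * t) *\<^sub>R ?g u)" using g by (rule integrable_scaleR_right)
  have "(\<lambda>u. exp (c * of_real u) * ?g u) \<in> borel_measurable lborel"
    using borel_measurable_integrable[OF g] by measurable
  then show "(\<lambda>u. indicator {0..t} u *\<^sub>R (exp (c * of_real u) * f u)) \<in> borel_measurable lborel"
    by simp
  show "AE u in lborel. norm (indicator {0..t} u *\<^sub>R (exp (c * of_real u) * f u))
      \<le> norm (exp (norm c * t) *\<^sub>R ?g u)"
  proof (rule AE_I2)
    fix u
    have "norm (exp (c * of_real u)) \<le> exp (norm c * t)" if "u \<in> {0..t}"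
    proof -
      have "norm (exp (c * of_real u)) \<le> exp (norm (c * of_real u))" by (rule norm_exp)
      also have "\<dots> \<le> exp (norm c * t)"
        using that by (auto simp: norm_mult intro: mult_left_mono)
      finally show ?thesis .
    qed
    then show "norm (indicator {0..t} u *\<^sub>R (exp (c * of_real u) * f u))
      \<le> norm (exp (norm c * t) *\<^sub>R ?g u)"
      by (auto simp: indicator_def norm_mult intro: mult_right_mono)
  qed
qed

text \<open>Absorbs the single bad points: u = 0, where the mass is 1 but its right limit is 2, and
  x = t, where the density jumps.\<close>

lemma set_integral_eq_except_point:
  fixes f g :: "real \<Rightarrow> complex"
  assumes "continuous_on {0..t} f"
    and eq: "\<And>u. u \<noteq> c \<Longrightarrow> indicator A u *\<^sub>R g u = indicator {0..t} u *\<^sub>R f u"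
  shows "set_integrable lborel A g" "(LINT u:A|lborel. g u) = integral {0..t} f"
proof -
  define d where "d = indicator A c *\<^sub>R g c - indicator {0..t} c *\<^sub>R f c"
  have f: "set_integrable lborel {0..t} f" by (rule borel_integrable_atLeastAtMost'[OF assms(1)])
  have *: "indicator A u *\<^sub>R g u = indicator {0..t} u *\<^sub>R f u + indicator {c} u *\<^sub>R d" for u
    using eq[of u] by (cases "u = c") (auto simp: d_def)
  have i0: "integrable lborel (\<lambda>u. indicator {c} u *\<^sub>R d)"
    by (intro integrable_scaleR_left) auto
  show "set_integrable lborel A g"
    using f i0 unfolding set_integrable_def * by (rule Bochner_Integration.integrable_add)
  have "integral\<^sup>L lborel (\<lambda>u. indicator A u *\<^sub>R g u) =
      integral\<^sup>L lborel (\<lambda>u. indicator {0..t} u *\<^sub>R f u) + integral\<^sup>L lborel (\<lambda>u. indicator {c} u *\<^sub>R d)"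
    unfolding * by (rule Bochner_Integration.integral_add[OF f[unfolded set_integrable_def] i0])
  moreover have "integral\<^sup>L lborel (\<lambda>u. indicator {c} u *\<^sub>R d) = 0"
    by simp
  ultimately show "(LINT u:A|lborel. g u) = integral {0..t} f"
    using set_borel_integral_eq_integral(2)[OF f] by (simp add: set_lebesgue_integral_def)
qed

lemma linear_ode_unique:
  fixes w :: "real \<Rightarrow> complex"
  assumes "\<And>t. t \<ge> 0 \<Longrightarrow> (w has_vector_derivative of_real z * w t) (at t within {0..})" "t \<ge> 0"
  shows "w t = w 0 * of_real (exp (z * t))"
proof -
  let ?e = "\<lambda>t. complex_of_real (exp (- z * t))"
  have "(?e has_vector_derivative of_real (- z * exp (- z * t))) (at t within {0..})" for t
    by (intro has_vector_derivative_of_real)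
      (auto intro!: derivative_eq_intros)
  from has_vector_derivative_mult[OF this assms(1)]
  have "((\<lambda>t. ?e t * w t) has_vector_derivative 0) (at t within {0..})" if "t \<ge> 0" for t
    using that by (simp add: algebra_simps)
  then obtain c where c: "\<forall>t\<in>{0..}. ?e t * w t = c"
    using has_derivative_zero_constant[of "{0..}" "\<lambda>t. ?e t * w t"] by (auto simp: has_vector_derivative_def)
  then have "?e t * w t = ?e 0 * w 0" using bspec[OF c, of t] bspec[OF c, of 0] \<open>t \<ge> 0\<close> by simp
  then have "of_real (exp (z * t)) * (?e t * w t) = w 0 * of_real (exp (z * t))" by simp
  moreover have "of_real (exp (z * t)) * ?e t = 1"
    by (simp flip: of_real_mult exp_add)
  ultimately show ?thesis by (metis mult.assoc mult_1)
qed

text \<open>The integrand is the derivative in u of e^(-a (t - u)) f(u).\<close>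

lemma duhamel:
  fixes f g :: "real \<Rightarrow> real"
  assumes "\<And>u. (f has_real_derivative - a * f u + c * g u) (at u within {0..t})" "t \<ge> 0"
  shows "integral {0..t} (\<lambda>u. exp (- of_real a * of_real (t - u)) * (of_real c * of_real (g u) :: complex)) =
    of_real (f t) - of_real (f 0) * exp (- of_real a * of_real t)"
proof -
  have "((\<lambda>u. complex_of_real (exp (- a * (t - u)) * f u)) has_vector_derivative
     of_real (exp (- a * (t - u)) * (c * g u))) (at u within {0..t})" for u
  proof (intro has_vector_derivative_of_real)
    have "((\<lambda>u. exp (- a * (t - u))) has_real_derivative a * exp (- a * (t - u))) (at u within {0..t})"
      by (auto intro!: derivative_eq_intros)
    from DERIV_mult[OF this assms(1)]
    show "((\<lambda>u. exp (- a * (t - u)) * f u) has_real_derivative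
       exp (- a * (t - u)) * (c * g u)) (at u within {0..t})"
      by (rule DERIV_cong) (simp add: algebra_simps)
  qed
  from fundamental_theorem_of_calculus[OF \<open>t \<ge> 0\<close> this]
  have "((\<lambda>u. complex_of_real (exp (- a * (t - u)) * (c * g u))) has_integral
     (of_real (exp (- a * (t - t)) * f t) - of_real (exp (- a * (t - 0)) * f 0))) {0..t}" .
  from integral_unique[OF this] show ?thesis
    by (simp add: exp_of_real[symmetric] mult_ac)
qed

section \<open>Characteristic roots, eigenvectors and total masses\<close>

locale renewal_system =
  fixes lam mu eta z1 z2 l1 l2 h1 h2 :: real
  assumes pos: "lam > 0" "mu > 0" "eta > 0"
    and z1: "z1 = (- (lam + mu + eta) + sqrt ((lam + mu + eta)\<^sup>2 - 4 * mu * eta)) / 2"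
    and z2: "z2 = (- (lam + mu + eta) - sqrt ((lam + mu + eta)\<^sup>2 - 4 * mu * eta)) / 2"
    and l1: "l1 = 2 * (z1 + eta) / (z1 - z2)" and l2: "l2 = - (2 * (z2 + eta) / (z1 - z2))"
    and h1: "h1 = 2 * lam / (z1 - z2)" and h2: "h2 = - (2 * lam / (z1 - z2))"
begin

lemma discriminant_pos: "(lam + mu + eta)\<^sup>2 - 4 * mu * eta > 0"
proof -
  have "(lam + mu + eta)\<^sup>2 - 4 * mu * eta = lam\<^sup>2 + 2 * lam * (mu + eta) + (mu - eta)\<^sup>2"
    by (simp add: power2_eq_square algebra_simps)
  also have "\<dots> > 0" using pos by (intro add_pos_nonneg add_pos_pos) auto
  finally show ?thesis .
qed

lemma root_gap: "z1 - z2 > 0"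
  using discriminant_pos by (simp add: z1 z2 field_simps)

lemma roots_sum: "z1 + z2 = - (lam + mu + eta)"
  by (simp add: z1 z2 field_simps)

lemma roots_prod: "z1 * z2 = mu * eta"
proof -
  have "(- (lam + mu + eta) + sqrt ((lam + mu + eta)\<^sup>2 - 4 * mu * eta)) *
      (- (lam + mu + eta) - sqrt ((lam + mu + eta)\<^sup>2 - 4 * mu * eta)) = 4 * mu * eta"
    using discriminant_pos by (simp add: algebra_simps power2_eq_square flip: real_sqrt_mult)
  then show ?thesis by (simp add: z1 z2)
qed

lemma roots_neg: "z1 < 0" "z2 < 0"
proof -
  show "z2 < 0" using root_gap roots_sum pos by linarith
  have "z1 * z2 > 0" using pos by (simp add: roots_prod)
  then show "z1 < 0" using \<open>z2 < 0\<close> by (simp add: zero_less_mult_iff)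
qed

text \<open>The characteristic equation of the matrix with rows (-(lam + mu), eta) and (lam, -eta),
  which drives the pair of total masses.\<close>

lemma root_eq1: "(z1 + (lam + mu)) * (z1 + eta) = lam * eta"
proof -
  have "(z1 + (lam + mu)) * (z1 + eta) = z1 * (z1 + (lam + mu + eta)) + (lam + mu) * eta"
    by (simp add: algebra_simps)
  also have "z1 + (lam + mu + eta) = - z2" using roots_sum by simp
  finally show ?thesis using roots_prod by (simp add: algebra_simps)
qed

lemma root_eq2: "(z2 + (lam + mu)) * (z2 + eta) = lam * eta"
proof -
  have "(z2 + (lam + mu)) * (z2 + eta) = z2 * (z2 + (lam + mu + eta)) + (lam + mu) * eta"
    by (simp add: algebra_simps)
  also have "z2 + (lam + mu + eta) = - z1" using roots_sum by simp
  finally show ?thesis using roots_prod by (simp add: algebra_simps)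
qed

lemma root_shift_nonzero: "z1 + eta \<noteq> 0" "z2 + eta \<noteq> 0" "lam + mu + z1 \<noteq> 0" "lam + mu + z2 \<noteq> 0"
  using root_eq1 root_eq2 pos by (auto simp: add.commute)

text \<open>The left side is the characteristic polynomial evaluated at -eta.\<close>

lemma roots_shift_prod: "(z1 + eta) * (z2 + eta) = - lam * eta"
proof -
  have "(z1 + eta) * (z2 + eta) = z1 * z2 + eta * (z1 + z2) + eta * eta" by (simp add: algebra_simps)
  then show ?thesis by (simp add: roots_prod roots_sum algebra_simps)
qed

text \<open>The total masses just after time 0: two unit sources in state 0 and nothing in state
  1.\<close>

lemma coeff_sums: "l1 + l2 = 2" "h1 + h2 = 0"
proof -
  have "l1 + l2 = 2 * (z1 - z2) / (z1 - z2)"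
    by (simp add: l1 l2 algebra_simps add_divide_distrib diff_divide_distrib)
  also have "\<dots> = 2" using root_gap by (intro nonzero_mult_div_cancel_right) simp
  finally show "l1 + l2 = 2" .
qed (simp add: h1 h2)

lemma coeff_scaled:
  "(z1 - z2) * l1 = 2 * (z1 + eta)" "(z1 - z2) * l2 = - (2 * (z2 + eta))"
  "(z1 - z2) * h1 = 2 * lam" "(z1 - z2) * h2 = - (2 * lam)"
  using root_gap by (simp_all add: l1 l2 h1 h2)

text \<open>Second row of the statement that (l1, h1) and (l2, h2) are eigenvectors for z1 and z2;
  \<open>coeff_rel_h\<close> is the first row, where the characteristic equation is used.\<close>

lemma coeff_rel_l: "lam * l1 = (z1 + eta) * h1" "lam * l2 = (z2 + eta) * h2"
  by (simp_all add: l1 l2 h1 h2)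

lemma coeff_rel_h: "eta * h1 = (z1 + (lam + mu)) * l1" "eta * h2 = (z2 + (lam + mu)) * l2"
proof -
  have "(z1 + (lam + mu)) * l1 = 2 * ((z1 + (lam + mu)) * (z1 + eta)) / (z1 - z2)" by (simp add: l1)
  then show "eta * h1 = (z1 + (lam + mu)) * l1" unfolding root_eq1 by (simp add: h1)
  have "(z2 + (lam + mu)) * l2 = - (2 * ((z2 + (lam + mu)) * (z2 + eta)) / (z1 - z2))" by (simp add: l2)
  then show "eta * h2 = (z2 + (lam + mu)) * l2" unfolding root_eq2 by (simp add: h2)
qed

definition mass0 :: "real \<Rightarrow> real" where
  "mass0 t = l1 * exp (z1 * t) + l2 * exp (z2 * t)"

definition mass1 :: "real \<Rightarrow> real" where
  "mass1 t = h1 * exp (z1 * t) + h2 * exp (z2 * t)"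

lemma mass_0 [simp]: "mass0 0 = 2" "mass1 0 = 0"
  by (simp_all add: mass0_def mass1_def coeff_sums)

lemma continuous_on_mass [continuous_intros]: "continuous_on A mass0" "continuous_on A mass1"
  unfolding mass0_def[abs_def] mass1_def[abs_def] by (intro continuous_intros)+

lemma mass0_deriv: "(mass0 has_real_derivative - (lam + mu) * mass0 t + eta * mass1 t) (at t within A)"
proof -
  have "- (lam + mu) * mass0 t + eta * mass1 t =
      (eta * h1 - (lam + mu) * l1) * exp (z1 * t) + (eta * h2 - (lam + mu) * l2) * exp (z2 * t)"
    by (simp add: mass0_def mass1_def algebra_simps)
  also have "\<dots> = l1 * (z1 * exp (z1 * t)) + l2 * (z2 * exp (z2 * t))"
    unfolding coeff_rel_h by (simp add: algebra_simps)
  finally show ?thesis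
    unfolding mass0_def[abs_def] by (auto intro!: derivative_eq_intros)
qed

lemma mass1_deriv: "(mass1 has_real_derivative - eta * mass1 t + lam * mass0 t) (at t within A)"
proof -
  have "- eta * mass1 t + lam * mass0 t =
      (lam * l1 - eta * h1) * exp (z1 * t) + (lam * l2 - eta * h2) * exp (z2 * t)"
    by (simp add: mass0_def mass1_def algebra_simps)
  also have "\<dots> = h1 * (z1 * exp (z1 * t)) + h2 * (z2 * exp (z2 * t))"
    unfolding coeff_rel_l by (simp add: algebra_simps)
  finally show ?thesis
    unfolding mass1_def[abs_def] by (auto intro!: derivative_eq_intros)
qed

text \<open>
  After passing to continuous representatives, \<open>(z + \<eta>) P\<^sub>0 + \<eta> P\<^sub>1\<close> is a left eigenvector
  combination for each root \<open>z\<close>, hence a multiple of \<open>e\<^sup>z\<^sup>t\<close>.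
\<close>

lemma volterra_unique:
  fixes P0 P1 :: "real \<Rightarrow> complex"
  assumes int: "\<And>t. t > 0 \<Longrightarrow> set_integrable lborel {0..t} P0" "\<And>t. t > 0 \<Longrightarrow> set_integrable lborel {0..t} P1"
    and P0: "\<And>t. t > 0 \<Longrightarrow> P0 t = 2 * exp (- of_real (lam + mu) * of_real t) +
      (LINT u:{0..t}|lborel. exp (- of_real (lam + mu) * of_real (t - u)) * (of_real eta * P1 u))"
    and P1: "\<And>t. t > 0 \<Longrightarrow> P1 t =
      (LINT u:{0..t}|lborel. exp (- of_real eta * of_real (t - u)) * (of_real lam * P0 u))"
    and "t > 0"
  shows "P0 t = of_real (mass0 t)" "P1 t = of_real (mass1 t)"
proof -
  \<comment> \<open>Splitting e^(-a (t - u)) into e^(-a t) e^(a u) moves the outer time out of the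
    integral, leaving an indefinite integral in t.\<close>
  define F where "F a P t = integral {0..t} (\<lambda>u. exp (of_real a * of_real u) * P u)"
    for a :: real and P :: "real \<Rightarrow> complex" and t
  have LINT_F: "(LINT u:{0..t}|lborel. exp (- of_real a * of_real (t - u)) * (of_real c * P u)) =
      exp (- of_real a * of_real t) * (of_real c * F a P t)"
    if "set_integrable lborel {0..t} P" for a c t and P :: "real \<Rightarrow> complex"
  proof -
    have "(LINT u:{0..t}|lborel. exp (- of_real a * of_real (t - u)) * (of_real c * P u)) =
       (LINT u:{0..t}|lborel. (exp (- of_real a * of_real t) * of_real c) * (exp (of_real a * of_real u) * P u))"
      by (simp add: algebra_simps flip: exp_add)
    also have "\<dots> = (exp (- of_real a * of_real t) * of_real c) * (LINT u:{0..t}|lborel. exp (of_real a * of_real u) * P u)"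
      by (rule set_integral_mult_right)
    finally show ?thesis
      using set_borel_integral_eq_integral(2)[OF set_integrable_exp_mult[OF that]]
      by (simp add: F_def mult.assoc)
  qed
  have cont_F: "continuous_on {0..} (F a P)"
    if P: "\<And>t. t > 0 \<Longrightarrow> set_integrable lborel {0..t} P" for a P
  proof -
    have "continuous_on {0..t} (F a P)" if "t > 0" for t
      unfolding F_def[abs_def]
      by (intro indefinite_integral_continuous_1 set_borel_integral_eq_integral(1)
          set_integrable_exp_mult P that)
    then show ?thesis
      unfolding continuous_on_eq_continuous_within
    proof (intro ballI)
      fix x assume c: "\<And>t. t > 0 \<Longrightarrow> \<forall>x\<in>{0..t}. continuous (at x within {0..t}) (F a P)"
        and x: "x \<in> {0 :: real..}"
      have "continuous (at x within {0..x + 1}) (F a P)" using c[of "x + 1"] x by auto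
      moreover have "at x within {0..x + 1} = at x within {0..}"
        using x by (intro at_within_nhd[of _ "{..<x + 1}"]) auto
      ultimately show "continuous (at x within {0..}) (F a P)" by simp
    qed
  qed
  \<comment> \<open>Continuous representatives: they agree with \<open>P0\<close> and
    \<open>P1\<close> for t > 0 and take the values 2 and 0 at t = 0.\<close>
  define c0 where "c0 t = exp (- of_real (lam + mu) * of_real t) * (2 + of_real eta * F (lam + mu) P1 t)" for t
  define c1 where "c1 t = exp (- of_real eta * of_real t) * (of_real lam * F eta P0 t)" for t
  have Pc: "P0 t = c0 t" "P1 t = c1 t" if "t > 0" for t
    using P0[OF that] P1[OF that] LINT_F[OF int(1)[OF that]] LINT_F[OF int(2)[OF that]]
    by (simp_all only: c0_def c1_def) (simp add: algebra_simps)
  have cont: "continuous_on {0..} c0" "continuous_on {0..} c1"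
    unfolding c0_def[abs_def] c1_def[abs_def] by (intro continuous_intros cont_F int; simp)+
  have F_deriv: "(F a P has_vector_derivative exp (of_real a * of_real t) * c t) (at t within {0..})"
    if "t \<ge> 0" "continuous_on {0..} c" "\<And>t. t > 0 \<Longrightarrow> P t = c t" for a P c t
  proof -
    \<comment> \<open>\<open>P\<close> and its continuous representative may differ at the null set
      {0}; after the replacement the fundamental theorem of calculus applies.\<close>
    have "F a P u = integral {0..u} (\<lambda>u. exp (of_real a * of_real u) * c u)" for u
      unfolding F_def by (rule integral_spike[of "{0}"]) (use that(3) in auto)
    then have "F a P = (\<lambda>u. integral {0..u} (\<lambda>u. exp (of_real a * of_real u) * c u))" ..
    then show ?thesis
      using integral_has_vector_derivative_halfline[of "\<lambda>u. exp (of_real a * of_real u) * c u" t] that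
      by (simp add: continuous_intros)
  qed
  have exp_deriv: "((\<lambda>t. exp (- of_real a * of_real t :: complex)) has_vector_derivative
      - of_real a * exp (- of_real a * of_real t)) (at t within {0..})" for a t
    by (rule has_vector_derivative_real_field) (auto intro!: derivative_eq_intros)
  have inv: "exp (- of_real a * of_real t) * exp (of_real a * of_real t) = (1 :: complex)" for a t :: real
    by (simp flip: exp_add)
  \<comment> \<open>The product rule in abstract form, with X and Y standing for e^(-a t) and e^(a
    t).\<close>
  have alg: "X * (e * (Y * c)) + - A * X * G = - A * (X * G) + e * c"
    if "X * Y = 1" for X Y A e c G :: complex
    using that by algebra
  have c0': "(c0 has_vector_derivative - of_real (lam + mu) * c0 t + of_real eta * c1 t) (at t within {0..})"
    if "t \<ge> 0" for t
  proof -
    have "((\<lambda>t. 2 + of_real eta * F (lam + mu) P1 t) has_vector_derivative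
        0 + of_real eta * (exp (of_real (lam + mu) * of_real t) * c1 t)) (at t within {0..})"
      by (intro has_vector_derivative_add has_vector_derivative_const has_vector_derivative_mult_right
          F_deriv that cont Pc)
    from has_vector_derivative_mult[OF exp_deriv this] show ?thesis
      unfolding c0_def[abs_def]
      by (rule has_vector_derivative_eq_rhs) (simp only: add_0_left alg[OF inv])
  qed
  have c1': "(c1 has_vector_derivative - of_real eta * c1 t + of_real lam * c0 t) (at t within {0..})"
    if "t \<ge> 0" for t
  proof -
    have "((\<lambda>t. of_real lam * F eta P0 t) has_vector_derivative
        of_real lam * (exp (of_real eta * of_real t) * c0 t)) (at t within {0..})"
      by (intro has_vector_derivative_mult_right F_deriv that cont Pc)
    from has_vector_derivative_mult[OF exp_deriv this] show ?thesis
      unfolding c1_def[abs_def]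
      by (rule has_vector_derivative_eq_rhs) (simp only: add_0_left alg[OF inv])
  qed
  have init: "c0 0 = 2" "c1 0 = 0" by (simp_all add: c0_def c1_def F_def)
  have eigen: "of_real (z + eta) * c0 t + of_real eta * c1 t = 2 * of_real (z + eta) * of_real (exp (z * t))"
    if z: "(z + (lam + mu)) * (z + eta) = lam * eta" for z
  proof -
    let ?w = "\<lambda>t. of_real (z + eta) * c0 t + of_real eta * c1 t"
    have "(?w has_vector_derivative of_real z * ?w t) (at t within {0..})" if "t \<ge> 0" for t
    proof (rule has_vector_derivative_eq_rhs)
      show "(?w has_vector_derivative
          of_real (z + eta) * (- of_real (lam + mu) * c0 t + of_real eta * c1 t)
          + of_real eta * (- of_real eta * c1 t + of_real lam * c0 t)) (at t within {0..})"
        by (intro has_vector_derivative_add has_vector_derivative_mult_right c0' c1' that)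
      have "(of_real z + (of_real lam + of_real mu)) * (of_real z + of_real eta) = of_real lam * (of_real eta :: complex)"
        using z by (metis of_real_add of_real_mult)
      then show "of_real (z + eta) * (- of_real (lam + mu) * c0 t + of_real eta * c1 t)
          + of_real eta * (- of_real eta * c1 t + of_real lam * c0 t) = of_real z * ?w t"
        unfolding of_real_add by algebra
    qed
    from linear_ode_unique[of ?w z t, OF this] \<open>t > 0\<close> show ?thesis by (simp add: init mult_ac)
  qed
  note e = eigen[OF root_eq1] eigen[OF root_eq2]
  have gap: "complex_of_real (z1 - z2) \<noteq> 0" using root_gap by simp
  have c0: "of_real (z1 - z2) * c0 t =
      2 * of_real (z1 + eta) * of_real (exp (z1 * t)) - 2 * of_real (z2 + eta) * of_real (exp (z2 * t))"
    unfolding e[symmetric] by (simp add: algebra_simps)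
  have "(z1 - z2) * mass0 t = ((z1 - z2) * l1) * exp (z1 * t) + ((z1 - z2) * l2) * exp (z2 * t)"
    by (simp add: mass0_def algebra_simps)
  also have "\<dots> = 2 * (z1 + eta) * exp (z1 * t) - 2 * (z2 + eta) * exp (z2 * t)"
    unfolding coeff_scaled by (simp add: algebra_simps)
  finally have "of_real (z1 - z2) * c0 t = of_real ((z1 - z2) * mass0 t)"
    unfolding c0 by simp
  then show "P0 t = of_real (mass0 t)" using gap Pc(1)[OF \<open>t > 0\<close>] by simp
  \<comment> \<open>Eliminates \<open>c0\<close> from the two eigenvector relations: (z1 + eta)
    times the second minus (z2 + eta) times the first.\<close>
  have c1: "of_real eta * (of_real (z1 - z2) * c1 t) =
      of_real (z1 + eta) * (2 * of_real (z2 + eta) * of_real (exp (z2 * t)))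
      - of_real (z2 + eta) * (2 * of_real (z1 + eta) * of_real (exp (z1 * t)))"
    unfolding e[symmetric] by (simp add: algebra_simps)
  have "eta * ((z1 - z2) * mass1 t) = eta * (((z1 - z2) * h1) * exp (z1 * t) + ((z1 - z2) * h2) * exp (z2 * t))"
    by (simp add: mass1_def algebra_simps)
  also have "\<dots> = - lam * eta * (2 * exp (z2 * t) - 2 * exp (z1 * t))"
    unfolding coeff_scaled by (simp add: algebra_simps)
  also have "\<dots> = (z1 + eta) * (2 * (z2 + eta) * exp (z2 * t)) - (z2 + eta) * (2 * (z1 + eta) * exp (z1 * t))"
    unfolding roots_shift_prod[symmetric] by (simp add: algebra_simps)
  finally have "of_real eta * (of_real (z1 - z2) * c1 t) = of_real (eta * ((z1 - z2) * mass1 t))"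
    unfolding c1 by simp
  then show "P1 t = of_real (mass1 t)" using gap Pc(2)[OF \<open>t > 0\<close>] pos by simp
qed

end

section \<open>The explicit solution\<close>

text \<open>The interval is closed at both ends, so a delta at the endpoint 0 contributes its full
  mass.\<close>

lemma delta_integral_eq:
  fixes g :: "real \<Rightarrow> 'a :: {banach, second_countable_topology}"
  assumes "g \<in> borel_measurable borel"
  shows "delta_integral c b g = (if 0 \<le> c \<and> c \<le> b then g c else 0)"
proof -
  have "(\<integral>z. indicator {0..b} z *\<^sub>R g z \<partial>return borel c) = indicator {0..b} c *\<^sub>R g c"
    using assms by (intro integral_return) auto
  then show ?thesis by (auto simp: delta_integral_def set_lebesgue_integral_def)
qed

lemma integral_two_terms:
  fixes f g :: "real \<Rightarrow> complex"
  assumes "continuous_on {0..t} f" "continuous_on {0..t} g"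
  shows "c * integral {0..t} f + d * integral {0..t} g = integral {0..t} (\<lambda>x. c * f x + d * g x)"
proof -
  have "integral {0..t} (\<lambda>x. c * f x + d * g x) =
      integral {0..t} (\<lambda>x. c * f x) + integral {0..t} (\<lambda>x. d * g x)"
    by (intro Henstock_Kurzweil_Integration.integral_add integrable_continuous_interval continuous_intros assms)
  then show ?thesis by simp
qed

lemma continuous_up_to_eval: "0 \<le> t \<Longrightarrow> continuous_up_to t (\<lambda>f. f t)"
  using continuous_up_to_eval_nderiv[of t 0] by simp

lemma test_fun_continuous_on: "test_fun \<phi> \<Longrightarrow> continuous_on {0..t} \<phi>"
  by (rule continuous_on_subset[OF continuous_on_smooth_halfline[OF test_funD]]) auto

lemma gf_of_fun_cut:
  fixes g k :: "real \<Rightarrow> real"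
  assumes "t > 0" "test_fun \<phi>" "continuous_on {0..t} k"
    and "\<And>x. x \<ge> 0 \<Longrightarrow> g x = (if x < t then k x else 0)"
  shows "gf_of_fun (\<lambda>x. of_real (g x)) \<phi> = integral {0..t} (\<lambda>x. of_real (k x) * \<phi> x)"
  unfolding gf_of_fun_def
  by (intro set_integral_eq_except_point(2)[where c=t] continuous_intros assms test_fun_continuous_on)
    (use assms in \<open>auto simp: indicator_def\<close>)

text \<open>The unit neighbourhood of x lies to the left of t, so a test function supported there
  sees neither the point mass at t nor the edge of the density.\<close>

lemma has_value_atI:
  fixes k :: "real \<Rightarrow> real"
  assumes "t > x + 1" "x \<ge> 0" "continuous_on UNIV k"
    and T: "\<And>\<phi>. test_fun \<phi> \<Longrightarrow> T \<phi> = c * \<phi> t + integral {0..t} (\<lambda>x. of_real (k x) * \<phi> x)"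
  shows "has_value_at T x (of_real (k x))"
  unfolding has_value_at_def
proof (intro exI[of _ 1] conjI exI[of _ "\<lambda>y. of_real (k y)"] allI impI)
  have k: "continuous_on A k" for A
    by (rule continuous_on_subset[OF assms(3)]) auto
  show "continuous_on ({0..} \<inter> cball x 1) (\<lambda>y. complex_of_real (k y))"
    by (intro continuous_intros k)
  fix \<phi> assume \<phi>: "test_fun \<phi>" and supp: "\<forall>y\<ge>0. 1 \<le> \<bar>y - x\<bar> \<longrightarrow> \<phi> y = 0"
  have "\<phi> y = 0" if "y \<ge> t" for y
    using supp that assms by auto
  moreover have "gf_of_fun (\<lambda>y. of_real (k y)) \<phi> = integral {0..t} (\<lambda>x. of_real (k x) * \<phi> x)"
    unfolding gf_of_fun_def
    by (intro set_integral_eq_except_point(2)[where c=t] continuous_intros k test_fun_continuous_on \<phi>)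
      (use calculation in \<open>auto simp: indicator_def\<close>)
  ultimately show "T \<phi> = gf_of_fun (\<lambda>y. of_real (k y)) \<phi>"
    using T[OF \<phi>] by simp
qed simp_all

section \<open>The candidate solution and its time derivative\<close>

context renewal_system
begin

text \<open>
  At \<open>t = 0\<close> only the initial value contributes; the mass from \<open>\<delta>(t)\<close> is present for \<open>t > 0\<close>.
\<close>

definition sol0 :: "real \<Rightarrow> functional" where
  "sol0 t f = (if t = 0 then f 0 else
     of_real (2 * exp (- (lam + mu) * t)) * f t +
     (of_real (eta * h1) * exp_conv (lam + mu) z1 t f + of_real (eta * h2) * exp_conv (lam + mu) z2 t f))"

definition sol1 :: "real \<Rightarrow> functional" where
  "sol1 t f = of_real (lam * l1) * exp_conv eta z1 t f + of_real (lam * l2) * exp_conv eta z2 t f"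

text \<open>The product rule applied to e^(-(lam + mu) t) f(t) gives the first two terms;
  \<open>has_vector_derivative_exp_conv\<close> gives the others.\<close>

definition sol0_deriv :: "real \<Rightarrow> functional" where
  "sol0_deriv t f =
     of_real (2 * exp (- (lam + mu) * t)) * nderiv 1 f t
     + of_real (- 2 * (lam + mu) * exp (- (lam + mu) * t)) * f t
     + (of_real (eta * h1) * (of_real z1 * exp_conv (lam + mu) z1 t f + of_real (exp (- (lam + mu) * t)) * f t)
     + of_real (eta * h2) * (of_real z2 * exp_conv (lam + mu) z2 t f + of_real (exp (- (lam + mu) * t)) * f t))"

definition sol1_deriv :: "real \<Rightarrow> functional" where
  "sol1_deriv t f =
     of_real (lam * l1) * (of_real z1 * exp_conv eta z1 t f + of_real (exp (- eta * t)) * f t)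
     + of_real (lam * l2) * (of_real z2 * exp_conv eta z2 t f + of_real (exp (- eta * t)) * f t)"

lemma continuous_up_to_sol0: "0 \<le> t \<Longrightarrow> continuous_up_to t (sol0 t)"
  unfolding sol0_def[abs_def]
  by (cases "t = 0")
    (auto intro!: continuous_up_to_add continuous_up_to_cmult continuous_up_to_exp_conv continuous_up_to_eval)

lemma continuous_up_to_sol1: "0 \<le> t \<Longrightarrow> continuous_up_to t (sol1 t)"
  unfolding sol1_def[abs_def]
  by (intro continuous_up_to_add continuous_up_to_cmult continuous_up_to_exp_conv)

lemma continuous_up_to_sol0_deriv: "0 \<le> t \<Longrightarrow> continuous_up_to t (sol0_deriv t)"
  unfolding sol0_deriv_def[abs_def]
  by (intro continuous_up_to_add continuous_up_to_cmult continuous_up_to_exp_conv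
      continuous_up_to_eval continuous_up_to_eval_nderiv)

lemma continuous_up_to_sol1_deriv: "0 \<le> t \<Longrightarrow> continuous_up_to t (sol1_deriv t)"
  unfolding sol1_deriv_def[abs_def]
  by (intro continuous_up_to_add continuous_up_to_cmult continuous_up_to_exp_conv
      continuous_up_to_eval)

lemma sol0_has_vector_derivative:
  assumes "t > 0" and f: "smooth_halfline f"
  shows "((\<lambda>u. sol0 u f) has_vector_derivative sol0_deriv t f) (at t)"
proof (rule has_vector_derivative_transform_within_open[where S="{0<..}"])
  have "at t within {0..} = at t" using \<open>t > 0\<close> by (intro at_within_interior) auto
  then have f': "(f has_vector_derivative nderiv 1 f t) (at t)"
    using has_vector_derivative_nderiv[OF f, of t 0] \<open>t > 0\<close> by simp
  have "((\<lambda>u. complex_of_real (2 * exp (- (lam + mu) * u))) has_vector_derivative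
      of_real (- 2 * (lam + mu) * exp (- (lam + mu) * t))) (at t)"
    by (intro has_vector_derivative_of_real) (auto intro!: derivative_eq_intros)
  note d = has_vector_derivative_mult[OF this f']
  show "((\<lambda>u. of_real (2 * exp (- (lam + mu) * u)) * f u +
     (of_real (eta * h1) * exp_conv (lam + mu) z1 u f + of_real (eta * h2) * exp_conv (lam + mu) z2 u f))
     has_vector_derivative sol0_deriv t f) (at t)"
    unfolding sol0_deriv_def
    by (intro has_vector_derivative_add has_vector_derivative_mult_right d
        has_vector_derivative_exp_conv f \<open>t > 0\<close>)
qed (use \<open>t > 0\<close> in \<open>auto simp: sol0_def\<close>)

lemma sol1_has_vector_derivative:
  assumes "t > 0" and f: "smooth_halfline f"
  shows "((\<lambda>u. sol1 u f) has_vector_derivative sol1_deriv t f) (at t)"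
  unfolding sol1_def sol1_deriv_def
  by (intro has_vector_derivative_add has_vector_derivative_mult_right has_vector_derivative_exp_conv f assms)

lemma derivative_commutes_sol:
  "derivative_commutes_with_laplace sol0" "derivative_commutes_with_laplace sol1"
proof -
  show "derivative_commutes_with_laplace sol0"
    by (rule derivative_commutes_with_laplaceI[where D=sol0_deriv])
      (simp_all add: continuous_up_to_sol0 continuous_up_to_sol0_deriv sol0_has_vector_derivative)
  show "derivative_commutes_with_laplace sol1"
    by (rule derivative_commutes_with_laplaceI[where D=sol1_deriv])
      (simp_all add: continuous_up_to_sol1 continuous_up_to_sol1_deriv sol1_has_vector_derivative)
qed

text \<open>State 0 is entered at time t - x at rate eta times the mass of state 1, and the
  exponential is the fraction surviving up to age x.\<close>

definition kernel0 :: "real \<Rightarrow> real \<Rightarrow> real" where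
  "kernel0 t x = eta * exp (- (lam + mu) * x) * mass1 (t - x)"

definition kernel1 :: "real \<Rightarrow> real \<Rightarrow> real" where
  "kernel1 t x = lam * exp (- eta * x) * mass0 (t - x)"

lemma continuous_on_kernel [continuous_intros]:
  "continuous_on A (kernel0 t)" "continuous_on A (kernel1 t)"
  unfolding kernel0_def[abs_def] kernel1_def[abs_def] mass0_def mass1_def
  by (intro continuous_intros)+

lemma sol0_eq_integral:
  assumes "continuous_on {0..t} f" "t > 0"
  shows "sol0 t f = of_real (2 * exp (- (lam + mu) * t)) * f t
    + integral {0..t} (\<lambda>x. of_real (kernel0 t x) * f x)"
proof -
  have "of_real (eta * h1) * exp_conv (lam + mu) z1 t f + of_real (eta * h2) * exp_conv (lam + mu) z2 t f =
    integral {0..t} (\<lambda>x. of_real (eta * h1) * (of_real (exp (- (lam + mu) * x) * exp (z1 * (t - x))) * f x)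
      + of_real (eta * h2) * (of_real (exp (- (lam + mu) * x) * exp (z2 * (t - x))) * f x))"
    unfolding exp_conv_def by (intro integral_two_terms continuous_intros assms)
  also have "\<dots> = integral {0..t} (\<lambda>x. of_real (kernel0 t x) * f x)"
    by (intro arg_cong[where f="integral _"] ext) (simp add: kernel0_def mass1_def algebra_simps)
  finally show ?thesis using \<open>t > 0\<close> by (simp add: sol0_def)
qed

lemma sol1_eq_integral:
  assumes "continuous_on {0..t} f"
  shows "sol1 t f = integral {0..t} (\<lambda>x. of_real (kernel1 t x) * f x)"
proof -
  have "sol1 t f =
    integral {0..t} (\<lambda>x. of_real (lam * l1) * (of_real (exp (- eta * x) * exp (z1 * (t - x))) * f x)
      + of_real (lam * l2) * (of_real (exp (- eta * x) * exp (z2 * (t - x))) * f x))"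
    unfolding sol1_def exp_conv_def by (intro integral_two_terms continuous_intros assms)
  also have "\<dots> = integral {0..t} (\<lambda>x. of_real (kernel1 t x) * f x)"
    by (intro arg_cong[where f="integral _"] ext) (simp add: kernel1_def mass0_def algebra_simps)
  finally show ?thesis .
qed

lemma laplace_sol0:
  assumes "t > 0"
  shows "laplace (sol0 t) s = 2 * exp (- (of_real (lam + mu) + s) * of_real t) +
    integral {0..t} (\<lambda>u. exp (- (of_real (lam + mu) + s) * of_real (t - u)) * (of_real eta * of_real (mass1 u)))"
proof -
  have "of_real (eta * h1) * exp_conv (lam + mu) z1 t (\<lambda>x. exp (- s * of_real x))
      + of_real (eta * h2) * exp_conv (lam + mu) z2 t (\<lambda>x. exp (- s * of_real x)) =
    integral {0..t} (\<lambda>u.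
      of_real (eta * h1) * (exp (- (of_real (lam + mu) + s) * of_real (t - u)) * of_real (exp (z1 * u)))
      + of_real (eta * h2) * (exp (- (of_real (lam + mu) + s) * of_real (t - u)) * of_real (exp (z2 * u))))"
    unfolding exp_conv_exp by (intro integral_two_terms continuous_intros)
  also have "\<dots> = integral {0..t} (\<lambda>u. exp (- (of_real (lam + mu) + s) * of_real (t - u)) * (of_real eta * of_real (mass1 u)))"
    unfolding mass1_def of_real_add of_real_mult
    by (intro arg_cong[where f="integral _"] ext) algebra
  finally show ?thesis
    using assms laplace_continuous_up_to[OF continuous_up_to_sol0, of t s]
    by (simp add: sol0_def exp_of_real[symmetric] algebra_simps flip: exp_add)
qed

lemma laplace_sol1:
  assumes "t \<ge> 0"
  shows "laplace (sol1 t) s =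
    integral {0..t} (\<lambda>u. exp (- (of_real eta + s) * of_real (t - u)) * (of_real lam * of_real (mass0 u)))"
proof -
  have "sol1 t (\<lambda>x. exp (- s * of_real x)) =
    integral {0..t} (\<lambda>u.
      of_real (lam * l1) * (exp (- (of_real eta + s) * of_real (t - u)) * of_real (exp (z1 * u)))
      + of_real (lam * l2) * (exp (- (of_real eta + s) * of_real (t - u)) * of_real (exp (z2 * u))))"
    unfolding sol1_def exp_conv_exp by (intro integral_two_terms continuous_intros)
  also have "\<dots> = integral {0..t} (\<lambda>u. exp (- (of_real eta + s) * of_real (t - u)) * (of_real lam * of_real (mass0 u)))"
    unfolding mass0_def of_real_add of_real_mult
    by (intro arg_cong[where f="integral _"] ext) algebra
  finally show ?thesis
    using assms laplace_continuous_up_to[OF continuous_up_to_sol1, of t s] by simp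
qed

text \<open>Closes the loop: the densities were built from \<open>mass0\<close> and
  \<open>mass1\<close>, and these must turn out to be the total masses of the candidate.\<close>

lemma laplace_sol0_0: "t > 0 \<Longrightarrow> laplace (sol0 t) 0 = of_real (mass0 t)"
  using laplace_sol0[of t 0] duhamel[of mass0 "lam + mu" eta mass1 t] mass0_deriv by simp

lemma laplace_sol1_0: "t \<ge> 0 \<Longrightarrow> laplace (sol1 t) 0 = of_real (mass1 t)"
  using laplace_sol1[of t 0] duhamel[of mass1 eta lam mass0 t] mass1_deriv by simp

lemma delta_integral_exp:
  "t > 0 \<Longrightarrow> delta_integral 0 t (\<lambda>u. exp (c * of_real (t - u))) = (exp (c * of_real t) :: complex)"
  by (subst delta_integral_eq) auto

lemma time_dependent_solution_sol: "time_dependent_solution lam mu eta sol0 sol1"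
  unfolding time_dependent_solution_def
proof (intro conjI allI impI)
  fix t :: real assume "t \<ge> 0"
  note c = continuous_up_to_sol0[OF this] continuous_up_to_sol1[OF this]
  show "generalized_function (sol0 t)" "generalized_function (sol1 t)"
    by (rule generalized_function_continuous_up_to[OF c(1)] generalized_function_continuous_up_to[OF c(2)])+
  show "laplace_exists (sol0 t) s" "laplace_exists (sol1 t) s" for s
    unfolding laplace_exists_def using c has_laplace_continuous_up_to by blast+
next
  fix s
  show "laplace (sol0 0) s = 1"
    using laplace_continuous_up_to[OF continuous_up_to_sol0, of 0 s] by (simp add: sol0_def)
  show "laplace (sol1 0) s = 0"
    using laplace_sol1[of 0 s] by simp
next
  fix t :: real assume "t > 0"
  \<comment> \<open>The exceptional point is u = 0, where the transform is 1 and
    \<open>mass0\<close> is 2.\<close>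
  show "set_integrable lborel {0..t} (\<lambda>u. laplace (sol0 u) 0)"
    by (rule set_integral_eq_except_point(1)[where f="\<lambda>u. of_real (mass0 u)" and c=0 and t=t])
      (auto simp: laplace_sol0_0 indicator_def intro!: continuous_intros)
  show "set_integrable lborel {0..t} (\<lambda>u. laplace (sol1 u) 0)"
    by (rule set_integral_eq_except_point(1)[where f="\<lambda>u. of_real (mass1 u)" and c=0 and t=t])
      (auto simp: laplace_sol1_0 indicator_def intro!: continuous_intros)
next
  fix t :: real and s assume "t > 0"
  have 0: "laplace (sol0 0) s = 1"
    using laplace_continuous_up_to[OF continuous_up_to_sol0, of 0 s] by (simp add: sol0_def)
  have 1: "laplace (sol1 0) s = 0"
    using laplace_sol1[of 0 s] by simp
  have "(LINT u:{0..t}|lborel. exp (- (of_real (lam + mu) + s) * of_real (t - u)) * (of_real eta * laplace (sol1 u) 0))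
      = integral {0..t} (\<lambda>u. exp (- (of_real (lam + mu) + s) * of_real (t - u)) * (of_real eta * of_real (mass1 u)))"
    by (rule set_integral_eq_except_point(2)[where c=0])
      (auto simp: laplace_sol1_0 indicator_def intro!: continuous_intros)
  then show "laplace (sol0 t) s =
          exp (- (of_real (lam + mu) + s) * of_real t) * laplace (sol0 0) s
          + delta_integral 0 t (\<lambda>u. exp (- (of_real (lam + mu) + s) * of_real (t - u)))
          + (LINT u:{0..t}|lborel. exp (- (of_real (lam + mu) + s) * of_real (t - u))
                                     * (of_real eta * laplace (sol1 u) 0))"
    unfolding 0 delta_integral_exp[OF \<open>t > 0\<close>] laplace_sol0[OF \<open>t > 0\<close>] by simp
  have "(LINT u:{0..t}|lborel. exp (- (of_real eta + s) * of_real (t - u)) * (of_real lam * laplace (sol0 u) 0))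
      = integral {0..t} (\<lambda>u. exp (- (of_real eta + s) * of_real (t - u)) * (of_real lam * of_real (mass0 u)))"
    by (rule set_integral_eq_except_point(2)[where c=0])
      (auto simp: laplace_sol0_0 indicator_def intro!: continuous_intros)
  then show "laplace (sol1 t) s =
          exp (- (of_real eta + s) * of_real t) * laplace (sol1 0) s
          + (LINT u:{0..t}|lborel. exp (- (of_real eta + s) * of_real (t - u))
                                     * (of_real lam * laplace (sol0 u) 0))"
    unfolding 1 using laplace_sol1[of t s] \<open>t > 0\<close> by simp
qed

section \<open>Uniqueness of the solution\<close>

lemma time_dependent_solution_unique:
  assumes sol: "time_dependent_solution lam mu eta p0 p1" and "t > 0"
  shows "gf_eq (p0 t) (sol0 t)" "gf_eq (p1 t) (sol1 t)"
proof -
  have init: "laplace (p0 0) s = 1" "laplace (p1 0) s = 0" if "Re s \<ge> 0" for s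
    using sol that unfolding time_dependent_solution_def by blast+
  \<comment> \<open>The initial value and the source \<delta>(t) contribute the same exponential,
    hence the factor 2.\<close>
  have eq0: "laplace (p0 t) s = 2 * exp (- (of_real (lam + mu) + s) * of_real t)
      + (LINT u:{0..t}|lborel. exp (- (of_real (lam + mu) + s) * of_real (t - u)) * (of_real eta * laplace (p1 u) 0))"
    and eq1: "laplace (p1 t) s =
      (LINT u:{0..t}|lborel. exp (- (of_real eta + s) * of_real (t - u)) * (of_real lam * laplace (p0 u) 0))"
    if "t > 0" "Re s \<ge> 0" for t s
  proof -
    have "laplace (p0 t) s =
          exp (- (of_real (lam + mu) + s) * of_real t) * laplace (p0 0) s
          + delta_integral 0 t (\<lambda>u. exp (- (of_real (lam + mu) + s) * of_real (t - u)))
          + (LINT u:{0..t}|lborel. exp (- (of_real (lam + mu) + s) * of_real (t - u))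
                                     * (of_real eta * laplace (p1 u) 0))"
      using sol that unfolding time_dependent_solution_def by blast
    then show "laplace (p0 t) s = 2 * exp (- (of_real (lam + mu) + s) * of_real t)
      + (LINT u:{0..t}|lborel. exp (- (of_real (lam + mu) + s) * of_real (t - u)) * (of_real eta * laplace (p1 u) 0))"
      unfolding init[OF that(2)] delta_integral_exp[OF that(1)] by simp
    have "laplace (p1 t) s =
          exp (- (of_real eta + s) * of_real t) * laplace (p1 0) s
          + (LINT u:{0..t}|lborel. exp (- (of_real eta + s) * of_real (t - u))
                                     * (of_real lam * laplace (p0 u) 0))"
      using sol that unfolding time_dependent_solution_def by blast
    then show "laplace (p1 t) s =
      (LINT u:{0..t}|lborel. exp (- (of_real eta + s) * of_real (t - u)) * (of_real lam * laplace (p0 u) 0))"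
      unfolding init[OF that(2)] by simp
  qed
  have mass: "laplace (p0 u) 0 = of_real (mass0 u)" "laplace (p1 u) 0 = of_real (mass1 u)" if "u > 0" for u
  proof -
    note vu = volterra_unique[where ?P0.0="\<lambda>u. laplace (p0 u) 0" and ?P1.0="\<lambda>u. laplace (p1 u) 0" and t=u]
    have int: "set_integrable lborel {0..t} (\<lambda>u. laplace (p0 u) 0)" "set_integrable lborel {0..t} (\<lambda>u. laplace (p1 u) 0)"
      if "t > 0" for t
      using sol that unfolding time_dependent_solution_def by blast+
    show "laplace (p0 u) 0 = of_real (mass0 u)" "laplace (p1 u) 0 = of_real (mass1 u)"
      using vu[OF int] eq0[where s=0] eq1[where s=0] that by simp_all
  qed
  \<comment> \<open>Once the masses are known for u > 0, the right-hand side is explicit at every s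
    and coincides with that of the candidate.\<close>
  have "(LINT u:{0..t}|lborel. exp (- (of_real (lam + mu) + s) * of_real (t - u)) * (of_real eta * laplace (p1 u) 0))
      = integral {0..t} (\<lambda>u. exp (- (of_real (lam + mu) + s) * of_real (t - u)) * (of_real eta * of_real (mass1 u)))" for s
    by (rule set_integral_eq_except_point(2)[where c=0])
      (auto simp: mass indicator_def intro!: continuous_intros)
  then have L0: "laplace (p0 t) s = laplace (sol0 t) s" if "Re s \<ge> 0" for s
    using eq0[OF \<open>t > 0\<close> that] laplace_sol0[OF \<open>t > 0\<close>, of s] by simp
  have "(LINT u:{0..t}|lborel. exp (- (of_real eta + s) * of_real (t - u)) * (of_real lam * laplace (p0 u) 0))
      = integral {0..t} (\<lambda>u. exp (- (of_real eta + s) * of_real (t - u)) * (of_real lam * of_real (mass0 u)))" for s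
    by (rule set_integral_eq_except_point(2)[where c=0])
      (auto simp: mass indicator_def intro!: continuous_intros)
  then have L1: "laplace (p1 t) s = laplace (sol1 t) s" if "Re s \<ge> 0" for s
    using eq1[OF \<open>t > 0\<close> that] laplace_sol1[of t s] \<open>t > 0\<close> by simp
  have gf: "generalized_function (p t)" and ex: "Re s \<ge> 0 \<Longrightarrow> has_laplace (p t) s (laplace (p t) s)"
    if "p = p0 \<or> p = p1" for p s
    using sol \<open>t > 0\<close> that has_laplace_laplace unfolding time_dependent_solution_def
    by (auto simp: less_imp_le)
  have c: "continuous_up_to t (sol0 t)" "continuous_up_to t (sol1 t)"
    using \<open>t > 0\<close> by (simp_all add: continuous_up_to_sol0 continuous_up_to_sol1)
  show "gf_eq (p0 t) (sol0 t)"
    by (rule laplace_unique[OF gf generalized_function_continuous_up_to[OF c(1)]])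
      (use ex L0 has_laplace_continuous_up_to[OF c(1)] laplace_continuous_up_to[OF c(1)] in \<open>auto, metis\<close>)
  show "gf_eq (p1 t) (sol1 t)"
    by (rule laplace_unique[OF gf generalized_function_continuous_up_to[OF c(2)]])
      (use ex L1 has_laplace_continuous_up_to[OF c(2)] laplace_continuous_up_to[OF c(2)] in \<open>auto, metis\<close>)
qed

section \<open>Comparison with the closed formulas\<close>

definition closed_form0 :: "real \<Rightarrow> real \<Rightarrow> real" where
  "closed_form0 t x =
  lam * eta * l1 / (z1 + eta) * exp (z1 * t) * exp (- (lam + mu - eta) * x)
  - lam * eta * l1 / (z1 + eta) * exp (- eta * t) * exp (- (lam + mu - eta) * x)
  + lam * eta * l2 / (z2 + eta) * exp (z2 * t) * exp (- (lam + mu - eta) * x)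
  - lam * eta * l2 / (z2 + eta) * exp (- eta * t) * exp (- (lam + mu - eta) * x)
  - lam * eta * l1 / (z1 + eta) * exp (z1 * t) * exp (- (lam + mu - eta) * x)
  + lam * eta * l1 / (z1 + eta) * exp (z1 * t) * exp (- (lam + mu + z1) * x)
  + lam * eta * l1 / (z1 + eta) * exp (- (lam + mu) * t)
      * delta_integral t x (\<lambda>z. exp (- (lam + mu - eta) * (x - z)))
  - lam * eta * l1 / (z1 + eta) * exp (- (lam + mu) * t)
      * delta_integral t x (\<lambda>z. exp (- (lam + mu + z1) * (x - z)))
  - lam * eta * l2 / (z2 + eta) * exp (z2 * t) * exp (- (lam + mu - eta) * x)
  + lam * eta * l2 / (z2 + eta) * exp (z2 * t) * exp (- (lam + mu + z2) * x)
  + lam * eta * l2 / (z2 + eta) * exp (- (lam + mu) * t)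
      * delta_integral t x (\<lambda>z. exp (- (lam + mu - eta) * (x - z)))
  - lam * eta * l2 / (z2 + eta) * exp (- (lam + mu) * t)
      * delta_integral t x (\<lambda>z. exp (- (lam + mu + z2) * (x - z)))"

definition closed_form1 :: "real \<Rightarrow> real \<Rightarrow> real" where
  "closed_form1 t x =
  2 * lam * exp ((lam + mu - eta) * x) * exp (- (lam + mu) * t)
  - 2 * lam * exp (- eta * t)
      * delta_integral t x (\<lambda>z. exp ((lam + mu - eta) * (x - z)))
  + lam * eta * h1 / (lam + mu + z1) * exp (z1 * t) * exp ((lam + mu - eta) * x)
  - lam * eta * h1 / (lam + mu + z1) * exp (- (lam + mu) * t) * exp ((lam + mu - eta) * x)
  + lam * eta * h2 / (lam + mu + z2) * exp (z2 * t) * exp ((lam + mu - eta) * x)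
  - lam * eta * h2 / (lam + mu + z2) * exp (- (lam + mu) * t) * exp ((lam + mu - eta) * x)
  - lam * eta * h1 / (lam + mu + z1) * exp (z1 * t) * exp ((lam + mu - eta) * x)
  + lam * eta * h1 / (lam + mu + z1) * exp (z1 * t) * exp (- (eta + z1) * x)
  + lam * eta * h1 / (lam + mu + z1) * exp (- eta * t)
      * delta_integral t x (\<lambda>z. exp ((lam + mu - eta) * (x - z)))
  - lam * eta * h1 / (lam + mu + z1) * exp (- eta * t)
      * delta_integral t x (\<lambda>z. exp (- (eta + z1) * (x - z)))
  - lam * eta * h2 / (lam + mu + z2) * exp (z2 * t) * exp ((lam + mu - eta) * x)
  + lam * eta * h2 / (lam + mu + z2) * exp (z2 * t) * exp (- (eta + z2) * x)
  + lam * eta * h2 / (lam + mu + z2) * exp (- eta * t)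
      * delta_integral t x (\<lambda>z. exp ((lam + mu - eta) * (x - z)))
  - lam * eta * h2 / (lam + mu + z2) * exp (- eta * t)
      * delta_integral t x (\<lambda>z. exp (- (eta + z2) * (x - z)))"

lemma delta_integral_exp_shift:
  "t > 0 \<Longrightarrow> delta_integral t x (\<lambda>z. exp (c * (x - z))) = (if t \<le> x then exp (c * (x - t)) else 0 :: real)"
  by (subst delta_integral_eq) auto

text \<open>The eigenvector relations turn the fractions of the closed formulas into the
  coefficients of \<open>mass1\<close> and \<open>mass0\<close> in the densities.\<close>

lemma formula_coeffs:
  "lam * eta * l1 / (z1 + eta) = eta * h1" "lam * eta * l2 / (z2 + eta) = eta * h2"
  "lam * eta * h1 / (lam + mu + z1) = lam * l1" "lam * eta * h2 / (lam + mu + z2) = lam * l2"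
proof -
  have "lam * eta * l1 = eta * h1 * (z1 + eta)" "lam * eta * l2 = eta * h2 * (z2 + eta)"
    "lam * eta * h1 = lam * l1 * (lam + mu + z1)" "lam * eta * h2 = lam * l2 * (lam + mu + z2)"
    using coeff_rel_l coeff_rel_h by algebra+
  then show "lam * eta * l1 / (z1 + eta) = eta * h1" "lam * eta * l2 / (z2 + eta) = eta * h2"
    "lam * eta * h1 / (lam + mu + z1) = lam * l1" "lam * eta * h2 / (lam + mu + z2) = lam * l2"
    using root_shift_nonzero by (metis nonzero_mult_div_cancel_right)+
qed

text \<open>For x < t the delta integrals vanish, the e^(z t) e^(-(lam + mu - eta) x) terms cancel
  in pairs, and the e^(-eta t) terms add up to a multiple of h1 + h2 = 0. For x \<ge> t the
  identities \<open>e2\<close> and \<open>e3\<close> match each remaining term with a delta integral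
  of opposite sign.\<close>

lemma closed_form0_eq:
  assumes "t > 0"
  shows "closed_form0 t x = (if x < t then kernel0 t x else 0)"
proof -
  have e1: "exp (z * t) * exp (- (lam + mu + z) * x) = exp (- (lam + mu) * x) * exp (z * (t - x))"
    and e2: "exp (- (lam + mu) * t) * exp (- (lam + mu - eta) * (x - t)) = exp (- eta * t) * exp (- (lam + mu - eta) * x)"
    and e3: "exp (- (lam + mu) * t) * exp (- (lam + mu + z) * (x - t)) = exp (z * t) * exp (- (lam + mu + z) * x)" for z
    unfolding exp_add[symmetric] by (simp_all add: algebra_simps)
  show ?thesis
  proof (cases "x < t")
    case True
    then have *: "(x < t) = True" "(t \<le> x) = False" by auto
    show ?thesis
      unfolding closed_form0_def kernel0_def mass1_def formula_coeffs delta_integral_exp_shift[OF \<open>t > 0\<close>]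
        * if_True if_False
      using e1[of z1] e1[of z2] coeff_sums(2) by algebra
  next
    case False
    then have *: "(x < t) = False" "(t \<le> x) = True" by auto
    show ?thesis
      unfolding closed_form0_def kernel0_def mass1_def formula_coeffs delta_integral_exp_shift[OF \<open>t > 0\<close>]
        * if_True if_False
      using e2 e3[of z1] e3[of z2] by algebra
  qed
qed

text \<open>The same cancellation, except that for x < t the leading term 2 lam e^((lam + mu - eta)
  x) e^(-(lam + mu) t) is removed by l1 + l2 = 2.\<close>

lemma closed_form1_eq:
  assumes "t > 0"
  shows "closed_form1 t x = (if x < t then kernel1 t x else 0)"
proof -
  have e1: "exp (z * t) * exp (- (eta + z) * x) = exp (- eta * x) * exp (z * (t - x))"
    and e2: "exp (- eta * t) * exp ((lam + mu - eta) * (x - t)) = exp (- (lam + mu) * t) * exp ((lam + mu - eta) * x)"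
    and e3: "exp (- eta * t) * exp (- (eta + z) * (x - t)) = exp (z * t) * exp (- (eta + z) * x)" for z
    unfolding exp_add[symmetric] by (simp_all add: algebra_simps)
  show ?thesis
  proof (cases "x < t")
    case True
    then have *: "(x < t) = True" "(t \<le> x) = False" by auto
    show ?thesis
      unfolding closed_form1_def kernel1_def mass0_def formula_coeffs delta_integral_exp_shift[OF \<open>t > 0\<close>]
        * if_True if_False
      using e1[of z1] e1[of z2] coeff_sums(1) by algebra
  next
    case False
    then have *: "(x < t) = False" "(t \<le> x) = True" by auto
    show ?thesis
      unfolding closed_form1_def kernel1_def mass0_def formula_coeffs delta_integral_exp_shift[OF \<open>t > 0\<close>]
        * if_True if_False
      using e2 e3[of z1] e3[of z2] coeff_sums(1) by algebra
  qed
qed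

lemma sol0_closed_form:
  assumes "t > 0" "test_fun \<phi>"
  shows "sol0 t \<phi> = of_real (2 * exp (- (lam + mu) * t)) * gf_delta t \<phi>
    + gf_of_fun (\<lambda>x. of_real (closed_form0 t x)) \<phi>"
  unfolding sol0_eq_integral[OF test_fun_continuous_on[OF assms(2)] assms(1)] gf_delta_def
  by (subst gf_of_fun_cut[OF assms continuous_on_kernel(1) closed_form0_eq[OF assms(1)]]) auto

lemma sol1_closed_form:
  assumes "t > 0" "test_fun \<phi>"
  shows "sol1 t \<phi> = gf_of_fun (\<lambda>x. of_real (closed_form1 t x)) \<phi>"
  unfolding sol1_eq_integral[OF test_fun_continuous_on[OF assms(2)]]
  by (subst gf_of_fun_cut[OF assms continuous_on_kernel(2) closed_form1_eq[OF assms(1)]]) auto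

section \<open>Long-time limit\<close>

lemma mass_tendsto_0: "(mass0 \<longlongrightarrow> 0) at_top" "(mass1 \<longlongrightarrow> 0) at_top"
proof -
  have "((\<lambda>t. exp (z * t)) \<longlongrightarrow> 0) at_top" if "z < 0" for z :: real
    by (rule filterlim_compose[OF exp_at_bot])
      (rule filterlim_tendsto_neg_mult_at_bot[OF tendsto_const that filterlim_ident])
  then show "(mass0 \<longlongrightarrow> 0) at_top" "(mass1 \<longlongrightarrow> 0) at_top"
    unfolding mass0_def[abs_def] mass1_def[abs_def] using roots_neg
    by (auto intro!: tendsto_add_zero tendsto_mult_right_zero)
qed

lemma kernel_tendsto_0: "((\<lambda>t. kernel0 t x) \<longlongrightarrow> 0) at_top" "((\<lambda>t. kernel1 t x) \<longlongrightarrow> 0) at_top"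
proof -
  have "filterlim (\<lambda>t. t - x) at_top at_top"
    using filterlim_tendsto_add_at_top[OF tendsto_const filterlim_ident, of "- x"] by simp
  from filterlim_compose[OF mass_tendsto_0(1) this] filterlim_compose[OF mass_tendsto_0(2) this]
  show "((\<lambda>t. kernel0 t x) \<longlongrightarrow> 0) at_top" "((\<lambda>t. kernel1 t x) \<longlongrightarrow> 0) at_top"
    unfolding kernel0_def kernel1_def by (auto intro!: tendsto_mult_right_zero)
qed

text \<open>Once t > x + 1 the point mass has moved past x, and the value at x is the kernel, which
  decays because both characteristic roots are negative.\<close>

lemma pointwise_limit_0:
  assumes sol: "time_dependent_solution lam mu eta p0 p1" and "x \<ge> 0"
  shows "pointwise_limit p0 x 0" "pointwise_limit p1 x 0"
proof -
  note uniq = time_dependent_solution_unique[OF sol, unfolded gf_eq_def, rule_format]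
  have "has_value_at (p0 t) x (of_real (kernel0 t x))" "has_value_at (p1 t) x (of_real (kernel1 t x))"
    if "t > x + 1" for t
  proof -
    have "t > 0" using that \<open>x \<ge> 0\<close> by simp
    show "has_value_at (p0 t) x (of_real (kernel0 t x))"
      by (rule has_value_atI[OF that \<open>x \<ge> 0\<close> continuous_on_kernel(1)])
        (simp only: uniq(1)[OF \<open>t > 0\<close>] sol0_eq_integral[OF test_fun_continuous_on \<open>t > 0\<close>])
    show "has_value_at (p1 t) x (of_real (kernel1 t x))"
      by (rule has_value_atI[OF that \<open>x \<ge> 0\<close> continuous_on_kernel(2), where c=0])
        (simp only: uniq(2)[OF \<open>t > 0\<close>] sol1_eq_integral[OF test_fun_continuous_on] mult_zero_left add_0_left)
  qed
  then have ev: "\<forall>\<^sub>F t in at_top. has_value_at (p0 t) x (of_real (kernel0 t x))"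
    "\<forall>\<^sub>F t in at_top. has_value_at (p1 t) x (of_real (kernel1 t x))"
    by (intro eventually_mono[OF eventually_gt_at_top[of "x + 1"]]; blast)+
  have lim: "((\<lambda>t. complex_of_real (kernel0 t x)) \<longlongrightarrow> 0) at_top" "((\<lambda>t. complex_of_real (kernel1 t x)) \<longlongrightarrow> 0) at_top"
    using kernel_tendsto_0[THEN tendsto_of_real, of x, where 'a=complex] by simp_all
  show "pointwise_limit p0 x 0"
    unfolding pointwise_limit_def
    by (intro exI[of _ "\<lambda>t. complex_of_real (kernel0 t x)"] conjI ev(1) lim(1))
  show "pointwise_limit p1 x 0"
    unfolding pointwise_limit_def
    by (intro exI[of _ "\<lambda>t. complex_of_real (kernel1 t x)"] conjI ev(2) lim(2))
qed

end

theorem theorem1: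
  fixes lam mu eta z1 z2 l1 l2 h1 h2 :: real
  assumes "lam > 0" and "mu > 0" and "eta > 0" and "lam + mu > eta"
    and "z1 = (- (lam + mu + eta) + sqrt ((lam + mu + eta)\<^sup>2 - 4 * mu * eta)) / 2"
    and "z2 = (- (lam + mu + eta) - sqrt ((lam + mu + eta)\<^sup>2 - 4 * mu * eta)) / 2"
    and "l1 = 2 * (z1 + eta) / (z1 - z2)" and "l2 = - (2 * (z2 + eta) / (z1 - z2))"
    and "h1 = 2 * lam / (z1 - z2)" and "h2 = - (2 * lam / (z1 - z2))"
  shows
    "(\<exists>p0 p1. time_dependent_solution lam mu eta p0 p1 \<and>
        derivative_commutes_with_laplace p0 \<and> derivative_commutes_with_laplace p1) \<and>
     (\<forall>p0 p1. time_dependent_solution lam mu eta p0 p1 \<and>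
        derivative_commutes_with_laplace p0 \<and> derivative_commutes_with_laplace p1 \<longrightarrow>
        (\<forall>t>0. gf_eq (p0 t)
          (\<lambda>\<phi>. complex_of_real (2 * exp (- (lam + mu) * t)) * gf_delta t \<phi> +
            gf_of_fun (\<lambda>x. complex_of_real (
                lam * eta * l1 / (z1 + eta) * exp (z1 * t) * exp (- (lam + mu - eta) * x)
              - lam * eta * l1 / (z1 + eta) * exp (- eta * t) * exp (- (lam + mu - eta) * x)
              + lam * eta * l2 / (z2 + eta) * exp (z2 * t) * exp (- (lam + mu - eta) * x)
              - lam * eta * l2 / (z2 + eta) * exp (- eta * t) * exp (- (lam + mu - eta) * x)
              - lam * eta * l1 / (z1 + eta) * exp (z1 * t) * exp (- (lam + mu - eta) * x)
              + lam * eta * l1 / (z1 + eta) * exp (z1 * t) * exp (- (lam + mu + z1) * x)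
              + lam * eta * l1 / (z1 + eta) * exp (- (lam + mu) * t)
                  * delta_integral t x (\<lambda>z. exp (- (lam + mu - eta) * (x - z)))
              - lam * eta * l1 / (z1 + eta) * exp (- (lam + mu) * t)
                  * delta_integral t x (\<lambda>z. exp (- (lam + mu + z1) * (x - z)))
              - lam * eta * l2 / (z2 + eta) * exp (z2 * t) * exp (- (lam + mu - eta) * x)
              + lam * eta * l2 / (z2 + eta) * exp (z2 * t) * exp (- (lam + mu + z2) * x)
              + lam * eta * l2 / (z2 + eta) * exp (- (lam + mu) * t)
                  * delta_integral t x (\<lambda>z. exp (- (lam + mu - eta) * (x - z)))
              - lam * eta * l2 / (z2 + eta) * exp (- (lam + mu) * t)
                  * delta_integral t x (\<lambda>z. exp (- (lam + mu + z2) * (x - z))))) \<phi>)) \<and>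
        (\<forall>t>0. gf_eq (p1 t)
          (gf_of_fun (\<lambda>x. complex_of_real (
                2 * lam * exp ((lam + mu - eta) * x) * exp (- (lam + mu) * t)
              - 2 * lam * exp (- eta * t)
                  * delta_integral t x (\<lambda>z. exp ((lam + mu - eta) * (x - z)))
              + lam * eta * h1 / (lam + mu + z1) * exp (z1 * t) * exp ((lam + mu - eta) * x)
              - lam * eta * h1 / (lam + mu + z1) * exp (- (lam + mu) * t) * exp ((lam + mu - eta) * x)
              + lam * eta * h2 / (lam + mu + z2) * exp (z2 * t) * exp ((lam + mu - eta) * x)
              - lam * eta * h2 / (lam + mu + z2) * exp (- (lam + mu) * t) * exp ((lam + mu - eta) * x)
              - lam * eta * h1 / (lam + mu + z1) * exp (z1 * t) * exp ((lam + mu - eta) * x)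
              + lam * eta * h1 / (lam + mu + z1) * exp (z1 * t) * exp (- (eta + z1) * x)
              + lam * eta * h1 / (lam + mu + z1) * exp (- eta * t)
                  * delta_integral t x (\<lambda>z. exp ((lam + mu - eta) * (x - z)))
              - lam * eta * h1 / (lam + mu + z1) * exp (- eta * t)
                  * delta_integral t x (\<lambda>z. exp (- (eta + z1) * (x - z)))
              - lam * eta * h2 / (lam + mu + z2) * exp (z2 * t) * exp ((lam + mu - eta) * x)
              + lam * eta * h2 / (lam + mu + z2) * exp (z2 * t) * exp (- (eta + z2) * x)
              + lam * eta * h2 / (lam + mu + z2) * exp (- eta * t)
                  * delta_integral t x (\<lambda>z. exp ((lam + mu - eta) * (x - z)))
              - lam * eta * h2 / (lam + mu + z2) * exp (- eta * t)
                  * delta_integral t x (\<lambda>z. exp (- (eta + z2) * (x - z))))))) \<and>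
        (\<forall>x\<ge>0. pointwise_limit p0 x 0 \<and> pointwise_limit p1 x 0))"
proof -
  interpret renewal_system lam mu eta z1 z2 l1 l2 h1 h2
    by unfold_locales fact+
  have form: "gf_eq (p0 t) (\<lambda>\<phi>. complex_of_real (2 * exp (- (lam + mu) * t)) * gf_delta t \<phi>
        + gf_of_fun (\<lambda>x. complex_of_real (closed_form0 t x)) \<phi>)"
    "gf_eq (p1 t) (gf_of_fun (\<lambda>x. complex_of_real (closed_form1 t x)))"
    if "time_dependent_solution lam mu eta p0 p1" "t > 0" for p0 p1 t
    using time_dependent_solution_unique[OF that] sol0_closed_form[OF that(2)] sol1_closed_form[OF that(2)]
    by (auto simp: gf_eq_def)
  show ?thesis
    using time_dependent_solution_sol derivative_commutes_sol pointwise_limit_0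
      form[unfolded closed_form0_def closed_form1_def]
    by blast
qed

end
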